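(* Consider the linear program $$(LP)\qquad\min_{x\in\mathbb{R}^n}\{\langle c,x\rangle\mid Bx\ge d,\ Ax=b\},$$ where $c\in\mathbb{R}^n$, $A\in\mathbb{R}^{m\times n}$ ($0<m<n$) has full rank, $b\in\operatorname{Im}A$, $B$ is a $p\times n$ full rank real matrix with $p\ge n$, and $d\in\mathbb{R}^p$. Assume that the optimal set $S(LP)$ is nonempty and bounded, and let $x^0\in\mathbb{R}^n$ satisfy $Bx^0>d$ and $Ax^0=b$. Let $$h(x)=\sum_{i=1}^p\theta(g_i(x)),\qquad g_i(x)=\langle B_i,x\rangle-d_i,$$ where $B_i\in\mathbb{R}^n$ is the $i$-th row of $B$ and $\theta\in\Gamma_0(\mathbb{R})$ is a function of Legendre type satisfying: $(0,\infty)\subset\operatorname{dom}\theta\subset[0,\infty)$; $\theta\in\mathcal{C}^3(0,\infty)$ and $\lim_{s\to0^+}\theta'(s)=-\infty$; $\theta''(s)>0$ for all $s>0$. Then $(H\text{-}SD)$ (with objective $f(x)=\langle c,x\rangle$, $C=\{x\mid Bx>d\}$ and initial condition $x(0)=x^0$) is well-posed and its solution $x(t)$ converges as $t\to+\infty$ to the unique solution $x^*$ of $$\min_{x\in S(LP)}\sum_{i\notin I_0}D_\theta(g_i(x),g_i(x^0)),$$ where $I_0=\{i\in\{1,\dots,p\}\mid g_i(x)=0\text{ for all }x\in S(LP)\}$.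
   Context: $\Gamma_0(\mathbb{R}^n)$ is the set of lower semicontinuous proper convex functions $\mathbb{R}^n\to\mathbb{R}\cup\{+\infty\}$. A function $g\in\Gamma_0(\mathbb{R}^n)$ is of Legendre type if it is differentiable on $\operatorname{int}\operatorname{dom}g$, $|\nabla g(x^j)|\to+\infty$ for every sequence $(x^j)\subset\operatorname{int}\operatorname{dom}g$ converging to a boundary point of $\operatorname{dom}g$, and $g$ is strictly convex on $\operatorname{int}\operatorname{dom}g$. For $r\geq 0$ and $s>0$, $D_\theta(r,s)=\theta(r)-\theta(s)-\theta'(s)(r-s)$ (equal to $+\infty$ if $\theta(r)=+\infty$). Set $\mathcal{A}_0=\ker A$, $\mathcal{F}=\{x\mid Bx>d,\ Ax=b\}$ and $H=\nabla^2h$ on $C$ (positive definite there). $(H\text{-}SD)$ is the Cauchy problem $\dot x(t)+\nabla_Hf_{|\mathcal{F}}(x(t))=0$, $x(0)=x^0\in\mathcal{F}$, where $\nabla_Hf_{|\mathcal{F}}(x)=H(x)^{-1}[I-A^T(AH(x)^{-1}A^T)^{-1}AH(x)^{-1}]\nabla f(x)$ is the gradient of $f_{|\mathcal{F}}$ for the Riemannian metric $(u,v)^H_x=\langle H(x)u,v\rangle$ on $\mathcal{F}$. It is well-posed if its maximal solution, defined on $(T_m,T_M)\ni0$, satisfies $T_M=+\infty$. *)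

theory Defs
  imports "HOL-Analysis.Analysis"
begin

section \<open>Convex functions with values in the extended reals\<close>

definition effective_domain :: "('a \<Rightarrow> ereal) \<Rightarrow> 'a set" where
  "effective_domain g = {x. g x < \<infinity>}"

text \<open>The real-valued function underlying \<open>g\<close>. It is meaningful only where \<open>g\<close> is finite;
  derivatives of \<open>g\<close> at interior points of the effective domain are derivatives of this function.\<close>
definition finite_part :: "('a \<Rightarrow> ereal) \<Rightarrow> 'a \<Rightarrow> real" where
  "finite_part g = (\<lambda>x. real_of_ereal (g x))"

definition proper :: "('a \<Rightarrow> ereal) \<Rightarrow> bool" where
  "proper g \<longleftrightarrow> (\<forall>x. g x \<noteq> -\<infinity>) \<and> effective_domain g \<noteq> {}"

definition lower_semicontinuous :: "('a::topological_space \<Rightarrow> ereal) \<Rightarrow> bool" where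
  "lower_semicontinuous g \<longleftrightarrow> (\<forall>a. open {x. a < g x})"

text \<open>Convexity of an extended-real-valued function is convexity of its epigraph.\<close>
definition convex_ereal :: "('a::real_vector \<Rightarrow> ereal) \<Rightarrow> bool" where
  "convex_ereal g \<longleftrightarrow> convex {(x, r::real). g x \<le> ereal r}"

definition Gamma0 :: "('a::euclidean_space \<Rightarrow> ereal) set" where
  "Gamma0 = {g. lower_semicontinuous g \<and> proper g \<and> convex_ereal g}"

definition gradient :: "('a::euclidean_space \<Rightarrow> real) \<Rightarrow> 'a \<Rightarrow> 'a" where
  "gradient f x = (THE v. GDERIV f x :> v)"

definition hessian :: "(real^'n \<Rightarrow> real) \<Rightarrow> real^'n \<Rightarrow> real^'n^'n" where
  "hessian f x = jacobian (gradient f) (at x)"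

definition strictly_convex_on :: "'a::real_vector set \<Rightarrow> ('a \<Rightarrow> real) \<Rightarrow> bool" where
  "strictly_convex_on S f \<longleftrightarrow> convex S \<and>
     (\<forall>x\<in>S. \<forall>y\<in>S. \<forall>t. x \<noteq> y \<and> 0 < t \<and> t < 1 \<longrightarrow>
        f ((1 - t) *\<^sub>R x + t *\<^sub>R y) < (1 - t) * f x + t * f y)"

definition legendre_type :: "('a::euclidean_space \<Rightarrow> ereal) \<Rightarrow> bool" where
  "legendre_type g \<longleftrightarrow> g \<in> Gamma0 \<and>
     (\<forall>x\<in>interior (effective_domain g). finite_part g differentiable (at x)) \<and>
     (\<forall>X a. (\<forall>j. X j \<in> interior (effective_domain g)) \<and> a \<in> frontier (effective_domain g) \<and>
         X \<longlonglongrightarrow> a \<longrightarrow>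
         filterlim (\<lambda>j. norm (gradient (finite_part g) (X j))) at_top sequentially) \<and>
     strictly_convex_on (interior (effective_domain g)) (finite_part g)"

definition Ck_on :: "nat \<Rightarrow> real set \<Rightarrow> (real \<Rightarrow> real) \<Rightarrow> bool" where
  "Ck_on k S f \<longleftrightarrow> (\<forall>j<k. \<forall>x\<in>S. (deriv ^^ j) f differentiable (at x)) \<and>
     continuous_on S ((deriv ^^ k) f)"

text \<open>Used only for \<open>0 \<le> r\<close> and \<open>0 < s\<close>, where \<open>\<theta> s\<close> is finite; then the value is \<open>\<infinity>\<close>
  exactly when \<open>\<theta> r = \<infinity>\<close>.\<close>
definition bregman :: "(real \<Rightarrow> ereal) \<Rightarrow> real \<Rightarrow> real \<Rightarrow> ereal" where
  "bregman \<theta> r s = \<theta> r - \<theta> s - ereal (deriv (finite_part \<theta>) s * (r - s))"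

section \<open>The Hessian Riemannian steepest descent\<close>

definition full_rank :: "real^'n^'m \<Rightarrow> bool" where
  "full_rank M \<longleftrightarrow> rank M = min CARD('m) CARD('n)"

text \<open>The gradient of \<open>f\<close>, restricted to \<open>{x \<in> C. A *v x = b}\<close>, for the metric
  given by the Hessian of \<open>h\<close>.\<close>
definition riemannian_gradient ::
  "real^'n^'m \<Rightarrow> (real^'n \<Rightarrow> ereal) \<Rightarrow> (real^'n \<Rightarrow> real) \<Rightarrow> real^'n \<Rightarrow> real^'n" where
  "riemannian_gradient A h f x =
     (let Hinv = matrix_inv (hessian (finite_part h) x)
      in (Hinv ** (mat 1 - transpose A ** matrix_inv (A ** Hinv ** transpose A) ** A ** Hinv))
           *v gradient f x)"

definition HSD_solution ::
  "(real^'n) set \<Rightarrow> real^'n^'m \<Rightarrow> real^'m \<Rightarrow> (real^'n \<Rightarrow> ereal) \<Rightarrow> (real^'n \<Rightarrow> real) \<Rightarrow> real^'n \<Rightarrow>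
   ereal \<Rightarrow> ereal \<Rightarrow> (real \<Rightarrow> real^'n) \<Rightarrow> bool" where
  "HSD_solution C A b h f x0 Tm TM x \<longleftrightarrow>
     Tm < 0 \<and> 0 < TM \<and> x 0 = x0 \<and>
     (\<forall>t\<in>einterval Tm TM. x t \<in> C \<and> A *v x t = b \<and>
        (x has_vector_derivative - riemannian_gradient A h f (x t)) (at t))"

text \<open>The value of \<open>x\<close> outside \<open>einterval Tm TM\<close> is irrelevant.\<close>
definition HSD_maximal_solution ::
  "(real^'n) set \<Rightarrow> real^'n^'m \<Rightarrow> real^'m \<Rightarrow> (real^'n \<Rightarrow> ereal) \<Rightarrow> (real^'n \<Rightarrow> real) \<Rightarrow> real^'n \<Rightarrow>
   ereal \<Rightarrow> ereal \<Rightarrow> (real \<Rightarrow> real^'n) \<Rightarrow> bool" where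
  "HSD_maximal_solution C A b h f x0 Tm TM x \<longleftrightarrow>
     HSD_solution C A b h f x0 Tm TM x \<and>
     (\<forall>Sm SM y. HSD_solution C A b h f x0 Sm SM y \<and> Sm \<le> Tm \<and> TM \<le> SM \<and>
         (\<forall>t\<in>einterval Tm TM. y t = x t) \<longrightarrow> Sm = Tm \<and> SM = TM)"

text \<open>Existence and uniqueness of the maximal solution are part of well-posedness.\<close>
definition HSD_well_posed ::
  "(real^'n) set \<Rightarrow> real^'n^'m \<Rightarrow> real^'m \<Rightarrow> (real^'n \<Rightarrow> ereal) \<Rightarrow> (real^'n \<Rightarrow> real) \<Rightarrow> real^'n \<Rightarrow>
   bool" where
  "HSD_well_posed C A b h f x0 \<longleftrightarrow>
     (\<exists>Tm x. HSD_maximal_solution C A b h f x0 Tm \<infinity> x \<and>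
        (\<forall>Sm SM y. HSD_maximal_solution C A b h f x0 Sm SM y \<longrightarrow>
           Sm = Tm \<and> SM = \<infinity> \<and> (\<forall>t\<in>einterval Tm \<infinity>. y t = x t)))"

section \<open>The linear program\<close>

definition LP_feasible ::
  "real^'n^'m \<Rightarrow> real^'m \<Rightarrow> real^'n^'p \<Rightarrow> real^'p \<Rightarrow> (real^'n) set" where
  "LP_feasible A b B d = {x. (\<forall>i. d $ i \<le> (B *v x) $ i) \<and> A *v x = b}"

definition LP_solutions ::
  "real^'n \<Rightarrow> real^'n^'m \<Rightarrow> real^'m \<Rightarrow> real^'n^'p \<Rightarrow> real^'p \<Rightarrow> (real^'n) set" where
  "LP_solutions c A b B d = {x. is_arg_min (\<lambda>x. c \<bullet> x) (\<lambda>x. x \<in> LP_feasible A b B d) x}"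

definition slack :: "real^'n^'p \<Rightarrow> real^'p \<Rightarrow> 'p \<Rightarrow> real^'n \<Rightarrow> real" where
  "slack B d i x = B $ i \<bullet> x - d $ i"

definition LP_barrier :: "(real \<Rightarrow> ereal) \<Rightarrow> real^'n^'p \<Rightarrow> real^'p \<Rightarrow> real^'n \<Rightarrow> ereal" where
  "LP_barrier \<theta> B d x = (\<Sum>i\<in>UNIV. \<theta> (slack B d i x))"

text \<open>The strict order on \<open>real^'p\<close> is not componentwise, hence the explicit quantifier.\<close>
definition LP_open_set :: "real^'n^'p \<Rightarrow> real^'p \<Rightarrow> (real^'n) set" where
  "LP_open_set B d = {x. \<forall>i. d $ i < (B *v x) $ i}"

definition LP_always_active ::
  "real^'n \<Rightarrow> real^'n^'m \<Rightarrow> real^'m \<Rightarrow> real^'n^'p \<Rightarrow> real^'p \<Rightarrow> 'p set" where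
  "LP_always_active c A b B d = {i. \<forall>x\<in>LP_solutions c A b B d. slack B d i x = 0}"

end

theory Submission
  imports Defs
begin

text \<open>
  Write \<open>\<psi> = \<theta>'\<close> and let \<open>P\<close> be the orthogonal projection onto \<open>ker A\<close>. Because the objective is linear,
  along a solution of the differential equation the vector \<open>P (\<nabla>h (x t))\<close> moves on the straight line
  \<open>P (\<nabla>h x0) - t P c\<close>. The map \<open>G x = P (\<nabla>h x) + A\<^sup>T A x\<close> is injective with invertible derivative on the
  open polyhedron \<open>C\<close>, so invariance of domain and the inverse function theorem yield existence,
  uniqueness and smoothness of the solution without any theory of ordinary differential equations:
  it is \<open>G\<^sup>-\<^sup>1\<close> applied to a line. Testing with \<open>x t - x0\<close> gives
  \<open>\<Sum>\<^sub>i (\<psi> (g\<^sub>i (x t)) - \<psi> (g\<^sub>i x0)) (g\<^sub>i (x t) - g\<^sub>i x0) = t \<langle>c, x0 - x t\<rangle>\<close>, which, as \<open>\<psi>\<close> tends to \<open>-\<infinity>\<close> at \<open>0\<close>,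
  keeps the path away from the boundary of \<open>C\<close> on bounded time intervals, so it exists for all \<open>t \<ge> 0\<close>.

  Testing with the difference of two optimal points \<open>y, y'\<close> eliminates both \<open>t\<close> and the constraints in \<open>I\<^sub>0\<close>:
  \<open>\<Sum>\<^sub>i\<^sub>\<notin>\<^sub>I\<^sub>0 (\<psi> (g\<^sub>i (x t)) - \<psi> (g\<^sub>i x0)) (g\<^sub>i y - g\<^sub>i y') = 0\<close>. Passing to the limit along a convergent sequence
  shows that every cluster point satisfies \<open>g\<^sub>i > 0\<close> for \<open>i \<notin> I\<^sub>0\<close> and the first-order optimality condition of
  the Bregman problem, whose solution is unique by strict monotonicity of \<open>\<psi>\<close>.
\<close>

section \<open>Linear algebra and convexity\<close>

lemma matrix_mul_matrix_inv:
  fixes M :: "real^'n^'n"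
  assumes "invertible M"
  shows "M ** matrix_inv M = mat 1"
  unfolding matrix_inv_def by (rule conjunct1[OF someI_ex[OF assms[unfolded invertible_def]]])

lemma matrix_vector_mul_matrix_inv:
  fixes M :: "real^'n^'n"
  assumes "invertible M"
  shows "M *v (matrix_inv M *v v) = v"
  by (simp add: matrix_vector_mul_assoc matrix_mul_matrix_inv[OF assms])

lemma positive_definite_invertible:
  fixes M :: "real^'n^'n"
  assumes "\<And>u. u \<noteq> 0 \<Longrightarrow> 0 < u \<bullet> (M *v u)"
  shows "invertible M"
  unfolding invertible_left_inverse matrix_left_invertible_ker
  using assms by (metis inner_zero_right less_irrefl)

lemma surj_imp_transpose_inj:
  fixes A :: "real^'n^'m"
  assumes "surj ((*v) A)" "v v* A = 0"
  shows "v = 0"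
proof -
  obtain y where "v = A *v y" using assms(1) by (metis surjD)
  then have "v \<bullet> v = (v v* A) \<bullet> y" by (simp add: dot_lmul_matrix)
  with assms(2) show ?thesis by simp
qed

text \<open>Surjectivity of \<open>A\<close> makes its transpose injective, so positive definiteness
  passes from \<open>M\<close> to the congruence. It serves both for the inverse Hessian and for the
  identity matrix.\<close>

lemma congruence_invertible:
  fixes A :: "real^'n^'m" and M :: "real^'n^'n"
  assumes A: "surj ((*v) A)" and M: "\<And>u. u \<noteq> 0 \<Longrightarrow> 0 < u \<bullet> (M *v u)"
  shows "invertible (A ** M ** transpose A)"
proof (rule positive_definite_invertible)
  fix v :: "real^'m" assume "v \<noteq> 0"
  then have "v v* A \<noteq> 0" using surj_imp_transpose_inj[OF A] by blast
  moreover have "v \<bullet> ((A ** M ** transpose A) *v v) = (v v* A) \<bullet> (M *v (v v* A))"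
    by (simp add: matrix_vector_mul_assoc[symmetric] dot_lmul_matrix)
  ultimately show "0 < v \<bullet> ((A ** M ** transpose A) *v v)" using M by simp
qed

text \<open>These are the two facts about the closed formula that enter later: tangency to the
  kernel of \<open>A\<close>, and that applying the Hessian returns the gradient up to an element of
  the row space, which the kernel projection removes.\<close>

lemma riemannian_gradient_characterization:
  fixes A :: "real^'n^'m"
  assumes A: "surj ((*v) A)"
    and pos: "\<And>u. u \<noteq> 0 \<Longrightarrow> 0 < u \<bullet> (hessian (finite_part h) x *v u)"
  shows "A *v riemannian_gradient A h f x = 0"
    and "\<exists>v. hessian (finite_part h) x *v riemannian_gradient A h f x = gradient f x - v v* A"
proof -
  define H where "H = hessian (finite_part h) x"
  define K where "K = matrix_inv H"
  define N where "N = A ** K ** transpose A"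
  define e where "e = gradient f x"
  \<comment> \<open>The Lagrange multiplier of the constraint \<open>A *v u = 0\<close>.\<close>
  define v where "v = matrix_inv N *v (A *v (K *v e))"
  have HK: "H *v (K *v u) = u" for u
    unfolding K_def by (intro matrix_vector_mul_matrix_inv positive_definite_invertible) (simp add: H_def pos)
  \<comment> \<open>Substituting \<open>w = K *v u\<close> turns this quadratic form into that of
    \<open>H\<close> at \<open>w\<close>.\<close>
  have "0 < u \<bullet> (K *v u)" if "u \<noteq> 0" for u
  proof -
    have "K *v u \<noteq> 0" using HK[of u] that by (metis matrix_vector_mult_0_right)
    then have "0 < (K *v u) \<bullet> (H *v (K *v u))" using pos by (simp add: H_def)
    then show ?thesis by (simp add: HK inner_commute)
  qed
  then have "invertible N" unfolding N_def by (rule congruence_invertible[OF A])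
  then have Nv: "N *v v = A *v (K *v e)"
    unfolding v_def by (rule matrix_vector_mul_matrix_inv)
  have rg: "riemannian_gradient A h f x = K *v (e - v v* A)"
    by (simp add: riemannian_gradient_def Let_def H_def[symmetric] K_def[symmetric] N_def[symmetric]
        e_def[symmetric] v_def matrix_vector_mul_assoc[symmetric] matrix_vector_mult_diff_rdistrib)
  have "A *v (K *v (v v* A)) = N *v v"
    by (simp add: N_def matrix_vector_mul_assoc[symmetric])
  then show "A *v riemannian_gradient A h f x = 0"
    unfolding rg by (simp add: matrix_vector_mult_diff_distrib Nv)
  show "\<exists>v. hessian (finite_part h) x *v riemannian_gradient A h f x = gradient f x - v v* A"
    unfolding rg HK H_def[symmetric] e_def[symmetric] by blast
qed

section \<open>Orthogonal projection onto the kernel of \<open>A\<close>\<close>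

definition kernel_projection :: "real^'n^'m \<Rightarrow> real^'n \<Rightarrow> real^'n" where
  "kernel_projection A z = z - (matrix_inv (A ** transpose A) *v (A *v z)) v* A"

lemma linear_kernel_projection: "linear (kernel_projection A)"
proof -
  have "kernel_projection A =
      (\<lambda>z. z - transpose A *v (matrix_inv (A ** transpose A) *v (A *v z)))"
    by (auto simp: kernel_projection_def)
  then show ?thesis
    by (auto intro!: linearI simp: algebra_simps matrix_vector_mult_scaleR simp del: transpose_matrix_vector)
qed

lemma kernel_projection_transpose:
  fixes A :: "real^'n^'m"
  assumes A: "surj ((*v) A)"
  shows "kernel_projection A (v v* A) = 0"
proof -
  have inv: "invertible (A ** transpose A)"
    using congruence_invertible[OF A, of "mat 1"] by simp
  have "matrix_inv (A ** transpose A) ** (A ** transpose A) = mat 1"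
    using matrix_mul_matrix_inv[OF inv] by (rule matrix_left_right_inverse[THEN iffD1])
  then have "matrix_inv (A ** transpose A) *v (A *v (v v* A)) = v"
    by (metis matrix_vector_mul_assoc matrix_vector_mul_lid transpose_matrix_vector)
  then show ?thesis by (simp add: kernel_projection_def)
qed

lemma kernel_projection_in_kernel:
  fixes A :: "real^'n^'m"
  assumes A: "surj ((*v) A)"
  shows "A *v kernel_projection A z = 0"
proof -
  have inv: "invertible (A ** transpose A)"
    using congruence_invertible[OF A, of "mat 1"] by simp
  have "A *v (w v* A) = (A ** transpose A) *v w" for w
    by (simp add: matrix_vector_mul_assoc[symmetric])
  then show ?thesis
    by (simp add: kernel_projection_def matrix_vector_mult_diff_distrib
        matrix_vector_mul_matrix_inv[OF inv])
qed

text \<open>The component removed by the projection lies in the row space of \<open>A\<close>, which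
  is orthogonal to the kernel.\<close>

lemma inner_kernel_projection:
  assumes "A *v u = 0"
  shows "kernel_projection A z \<bullet> u = z \<bullet> u"
  using assms by (simp add: kernel_projection_def inner_diff_left dot_lmul_matrix)

text \<open>The two summands are orthogonal, since the range of the transpose is the orthogonal complement of the kernel.\<close>
lemma kernel_projection_add_transpose_eq_iff:
  fixes A :: "real^'n^'m"
  assumes A: "surj ((*v) A)"
  shows "kernel_projection A z + v v* A = kernel_projection A z' + v' v* A \<longleftrightarrow>
    kernel_projection A z = kernel_projection A z' \<and> v = v'"
proof
  assume eq: "kernel_projection A z + v v* A = kernel_projection A z' + v' v* A"
  have "A *v ((v - v') v* A) = A *v (v v* A) - A *v (v' v* A)"
    by (metis matrix_vector_mult_diff_distrib transpose_matrix_vector)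
  also have "\<dots> = A *v (kernel_projection A z + v v* A) - A *v (kernel_projection A z' + v' v* A)"
    by (simp add: matrix_vector_right_distrib kernel_projection_in_kernel[OF A])
  finally have "A *v ((v - v') v* A) = 0" by (simp add: eq)
  then have "((v - v') v* A) \<bullet> ((v - v') v* A) = 0" by (subst dot_lmul_matrix) simp
  then have "v - v' = 0" by (intro surj_imp_transpose_inj[OF A]) simp
  then show "kernel_projection A z = kernel_projection A z' \<and> v = v'" using eq by simp
qed simp

section \<open>Gradients, slacks and the open polyhedron\<close>

lemma gradient_eqI: "GDERIV f x :> v \<Longrightarrow> gradient f x = v"
  unfolding gradient_def
proof (rule the_equality)
  fix w assume "GDERIV f x :> v" "GDERIV f x :> w"
  then have "(\<lambda>h. h \<bullet> v) = (\<lambda>h. h \<bullet> w)" unfolding gderiv_def by (rule has_derivative_unique)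
  then have "\<forall>z. z \<bullet> w = z \<bullet> v" by (simp add: fun_eq_iff)
  then show "w = v" by (simp only: vector_eq_ldot)
qed

lemma slack_diff: "slack B d i x - slack B d i y = B $ i \<bullet> (x - y)"
  by (simp add: slack_def inner_diff_right)

lemma mem_LP_open_set_iff: "x \<in> LP_open_set B d \<longleftrightarrow> (\<forall>i. 0 < slack B d i x)"
  by (simp add: LP_open_set_def slack_def matrix_vector_mul_component)

lemma mem_LP_feasible_iff: "x \<in> LP_feasible A b B d \<longleftrightarrow> (\<forall>i. 0 \<le> slack B d i x) \<and> A *v x = b"
  by (simp add: LP_feasible_def slack_def matrix_vector_mul_component)

lemma continuous_on_slack: "continuous_on T (slack B d i)"
  unfolding slack_def[abs_def] by (intro continuous_intros)

lemma open_LP_open_set: "open (LP_open_set B d)"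
proof -
  have "LP_open_set B d = (\<Inter>i. {x. 0 < slack B d i x})" by (auto simp: mem_LP_open_set_iff)
  then show "open (LP_open_set B d)"
    by (auto intro!: open_INT open_Collect_less continuous_on_slack continuous_intros)
qed

section \<open>The barrier\<close>

text \<open>Full rank is recorded as surjectivity of \<open>A\<close> and injectivity of
  \<open>B\<close>, which is its meaning for m < n and n \<le> p.\<close>

locale linear_program_barrier =
  fixes c x0 :: "real^'n"
    and A :: "real^'n^'m" and b :: "real^'m"
    and B :: "real^'n^'p" and d :: "real^'p"
    and \<theta> :: "real \<Rightarrow> ereal"
  assumes surj_A: "surj ((*v) A)" and inj_B: "inj ((*v) B)"
    and solution_exists: "LP_solutions c A b B d \<noteq> {}"
    and solutions_bounded: "bounded (LP_solutions c A b B d)"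
    and x0_open: "x0 \<in> LP_open_set B d" and x0_affine: "A *v x0 = b"
    and theta_Gamma0: "\<theta> \<in> Gamma0"
    and theta_dom: "{0<..} \<subseteq> effective_domain \<theta>"
    and theta_C3: "Ck_on 3 {0<..} (finite_part \<theta>)"
    and theta_deriv_lim: "filterlim (deriv (finite_part \<theta>)) at_bot (at_right 0)"
    and theta_deriv2_pos: "\<And>s. s > 0 \<Longrightarrow> deriv (deriv (finite_part \<theta>)) s > 0"
begin

abbreviation "C \<equiv> LP_open_set B d"
abbreviation "S \<equiv> LP_solutions c A b B d"
abbreviation "g \<equiv> slack B d"
abbreviation "\<psi> \<equiv> deriv (finite_part \<theta>)"
abbreviation "h \<equiv> LP_barrier \<theta> B d"

definition barrier_gradient :: "real^'n \<Rightarrow> real^'n" where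
  "barrier_gradient x = (\<Sum>i\<in>UNIV. \<psi> (g i x) *\<^sub>R B $ i)"

text \<open>The operator B^T diag(\<theta>''(g_i x)) B, applied to \<open>u\<close>.\<close>

definition barrier_hessian :: "real^'n \<Rightarrow> real^'n \<Rightarrow> real^'n" where
  "barrier_hessian x u = (\<Sum>i\<in>UNIV. (deriv \<psi> (g i x) * (B $ i \<bullet> u)) *\<^sub>R B $ i)"

lemma theta_finite: "s > 0 \<Longrightarrow> \<theta> s = ereal (finite_part \<theta> s)"
  using theta_dom theta_Gamma0 unfolding finite_part_def Gamma0_def proper_def effective_domain_def
  by (subst ereal_real') (auto simp: greaterThan_def subset_iff)

lemma DERIV_theta: "s > 0 \<Longrightarrow> (finite_part \<theta> has_real_derivative \<psi> s) (at s)"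
proof -
  assume s: "s > 0"
  then have "(deriv ^^ 0) (finite_part \<theta>) differentiable (at s)"
    using theta_C3 unfolding Ck_on_def by (metis greaterThan_iff zero_less_numeral)
  then show ?thesis by (simp add: DERIV_deriv_iff_real_differentiable)
qed

lemma DERIV_psi: "s > 0 \<Longrightarrow> (\<psi> has_real_derivative deriv \<psi> s) (at s)"
proof -
  assume s: "s > 0"
  have "(1::nat) < 3" by simp
  with s have "(deriv ^^ 1) (finite_part \<theta>) differentiable (at s)"
    using theta_C3 unfolding Ck_on_def by (metis greaterThan_iff)
  then show ?thesis by (simp add: DERIV_deriv_iff_real_differentiable)
qed

lemma psi_less: "\<lbrakk>0 < r; r < s\<rbrakk> \<Longrightarrow> \<psi> r < \<psi> s"
  by (rule DERIV_pos_imp_increasing[of r s \<psi>]) (use DERIV_psi theta_deriv2_pos less_le_trans in blast)+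

lemma psi_diff_mult_nonneg: "\<lbrakk>0 < r; 0 < s\<rbrakk> \<Longrightarrow> 0 \<le> (\<psi> r - \<psi> s) * (r - s)"
  by (cases r s rule: linorder_cases) (auto simp: zero_le_mult_iff dest: psi_less)

lemma psi_diff_mult_eq_0: "\<lbrakk>0 < r; 0 < s; (\<psi> r - \<psi> s) * (r - s) = 0\<rbrakk> \<Longrightarrow> r = s"
  by (cases r s rule: linorder_cases) (auto dest: psi_less)

lemma isCont_psi: "s > 0 \<Longrightarrow> isCont \<psi> s"
  using DERIV_psi DERIV_isCont by blast

lemma row_inner_eq_0: "(\<And>i. B $ i \<bullet> u = 0) \<Longrightarrow> u = 0"
proof -
  assume "\<And>i. B $ i \<bullet> u = 0"
  then have "B *v u = B *v 0" by (simp add: vec_eq_iff matrix_vector_mul_component)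
  then show "u = 0" using inj_B by (meson injD)
qed

lemma slack_pos: "x \<in> C \<Longrightarrow> 0 < g i x"
  by (simp add: mem_LP_open_set_iff)

lemma barrier_gradient_inner:
  "barrier_gradient x \<bullet> u = (\<Sum>i\<in>UNIV. \<psi> (g i x) * (B $ i \<bullet> u))"
  by (simp add: barrier_gradient_def inner_sum_left)

lemma barrier_hessian_inner:
  "barrier_hessian x u \<bullet> v = (\<Sum>i\<in>UNIV. deriv \<psi> (g i x) * (B $ i \<bullet> u) * (B $ i \<bullet> v))"
  by (simp add: barrier_hessian_def inner_sum_left)

text \<open>Since \<open>B\<close> is injective, some row has nonzero inner product with
  \<open>u\<close>; its term is positive and no term is negative.\<close>

lemma barrier_hessian_pos:
  assumes "x \<in> C" "u \<noteq> 0"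
  shows "0 < barrier_hessian x u \<bullet> u"
proof -
  obtain i where i: "B $ i \<bullet> u \<noteq> 0" using assms(2) row_inner_eq_0 by blast
  show ?thesis unfolding barrier_hessian_inner mult.assoc
  proof (rule sum_pos2[of UNIV i])
    show "0 < deriv \<psi> (g i x) * (B $ i \<bullet> u * (B $ i \<bullet> u))"
      using theta_deriv2_pos[OF slack_pos[OF assms(1)], of i] i
      by (simp add: zero_less_mult_iff linorder_neq_iff disj_commute)
    show "0 \<le> deriv \<psi> (g j x) * (B $ j \<bullet> u * (B $ j \<bullet> u))" for j
      using theta_deriv2_pos[OF slack_pos[OF assms(1)], of j] by simp
  qed auto
qed

text \<open>The inner product is a sum of nonnegative terms, so each vanishes. Strict monotonicity
  of \<open>\<psi>\<close> then equates all slacks, and injectivity of \<open>B\<close> equates the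
  points.\<close>

lemma barrier_gradient_monotone:
  assumes "x \<in> C" "y \<in> C" "(barrier_gradient x - barrier_gradient y) \<bullet> (x - y) = 0"
  shows "x = y"
proof -
  have "(barrier_gradient x - barrier_gradient y) \<bullet> (x - y)
      = (\<Sum>i\<in>UNIV. (\<psi> (g i x) - \<psi> (g i y)) * (g i x - g i y))"
    by (simp add: inner_diff_left barrier_gradient_inner slack_diff left_diff_distrib sum_subtractf)
  then have "(\<psi> (g i x) - \<psi> (g i y)) * (g i x - g i y) = 0" for i
    using assms sum_nonneg_eq_0_iff[of UNIV "\<lambda>i. (\<psi> (g i x) - \<psi> (g i y)) * (g i x - g i y)"]
    by (simp add: psi_diff_mult_nonneg slack_pos)
  then have "g i x = g i y" for i using psi_diff_mult_eq_0 slack_pos assms(1,2) by blast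
  then have "B $ i \<bullet> (x - y) = 0" for i by (simp flip: slack_diff[of B d])
  then show ?thesis using row_inner_eq_0[of "x - y"] by simp
qed

lemma slack_has_derivative: "(g i has_derivative (\<lambda>u. B $ i \<bullet> u)) (at x)"
  unfolding slack_def[abs_def] by (auto intro!: derivative_eq_intros)

lemma barrier_gradient_has_derivative:
  assumes "x \<in> C"
  shows "(barrier_gradient has_derivative barrier_hessian x) (at x)"
proof -
  have "((\<lambda>x. \<psi> (g i x)) has_derivative (\<lambda>u. deriv \<psi> (g i x) * (B $ i \<bullet> u))) (at x)" for i
    using has_derivative_compose[OF slack_has_derivative]
      DERIV_psi[OF slack_pos[OF assms], of i, unfolded has_field_derivative_def] by blast
  then show ?thesis unfolding barrier_gradient_def[abs_def] barrier_hessian_def[abs_def]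
    by (intro has_derivative_sum has_derivative_scaleR_left)
qed

lemma finite_part_barrier: "x \<in> C \<Longrightarrow> finite_part h x = (\<Sum>i\<in>UNIV. finite_part \<theta> (g i x))"
proof -
  assume "x \<in> C"
  then have "h x = (\<Sum>i\<in>UNIV. ereal (finite_part \<theta> (g i x)))"
    unfolding LP_barrier_def by (intro sum.cong refl theta_finite slack_pos)
  then show ?thesis by (simp add: finite_part_def[of h])
qed

lemma gradient_barrier:
  assumes "x \<in> C"
  shows "gradient (finite_part h) x = barrier_gradient x"
proof (rule gradient_eqI)
  have "((\<lambda>x. finite_part \<theta> (g i x)) has_derivative (\<lambda>u. \<psi> (g i x) * (B $ i \<bullet> u))) (at x)" for i
    using has_derivative_compose[OF slack_has_derivative]
      DERIV_theta[OF slack_pos[OF assms], of i, unfolded has_field_derivative_def] by blast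
  then have "((\<lambda>x. \<Sum>i\<in>UNIV. finite_part \<theta> (g i x)) has_derivative
      (\<lambda>u. \<Sum>i\<in>UNIV. \<psi> (g i x) * (B $ i \<bullet> u))) (at x)"
    by (rule has_derivative_sum)
  then have "(finite_part h has_derivative (\<lambda>u. \<Sum>i\<in>UNIV. \<psi> (g i x) * (B $ i \<bullet> u))) (at x)"
    by (rule has_derivative_transform_within_open[OF _ open_LP_open_set assms])
      (simp add: finite_part_barrier)
  then show "GDERIV (finite_part h) x :> barrier_gradient x"
    by (simp add: gderiv_def barrier_gradient_inner[symmetric] inner_commute[of _ "barrier_gradient x"])
qed

lemma hessian_barrier:
  assumes "x \<in> C"
  shows "hessian (finite_part h) x *v u = barrier_hessian x u"
proof -
  \<comment> \<open>The abstract gradient is known only on \<open>C\<close>; openness of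
    \<open>C\<close> suffices to transfer the derivative.\<close>
  have der: "(gradient (finite_part h) has_derivative barrier_hessian x) (at x)"
    by (rule has_derivative_transform_within_open[OF barrier_gradient_has_derivative open_LP_open_set])
      (use assms gradient_barrier in auto)
  then have "gradient (finite_part h) differentiable (at x)" by (rule differentiableI)
  then have "(gradient (finite_part h) has_derivative (*v) (hessian (finite_part h) x)) (at x)"
    unfolding hessian_def by (simp add: jacobian_works)
  then show ?thesis using has_derivative_unique[OF der] by (simp add: fun_eq_iff)
qed


section \<open>The flow in closed form\<close>

abbreviation "projA \<equiv> kernel_projection A"

lemmas linear_projA = linear_kernel_projection[of A]

text \<open>The first summand lies in the kernel of \<open>A\<close>, the second in its row space.
  Recording both the projected gradient and the constraint value gives a map between spaces of equal
  dimension, as invariance of domain requires.\<close>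

definition G :: "real^'n \<Rightarrow> real^'n" where
  "G x = projA (barrier_gradient x) + (A *v x) v* A"

definition dG :: "real^'n \<Rightarrow> real^'n \<Rightarrow> real^'n" where
  "dG x u = projA (barrier_hessian x u) + (A *v u) v* A"

definition target :: "real \<Rightarrow> real^'n" where
  "target t = projA (barrier_gradient x0 - t *\<^sub>R c) + b v* A"

lemma projA_eq_imp_inner_eq: "\<lbrakk>projA z = projA z'; A *v u = 0\<rbrakk> \<Longrightarrow> z \<bullet> u = z' \<bullet> u"
  by (metis inner_kernel_projection)

lemma G_eq_target_iff:
  "G x = target t \<longleftrightarrow> projA (barrier_gradient x) = projA (barrier_gradient x0 - t *\<^sub>R c) \<and> A *v x = b"
  unfolding G_def target_def by (rule kernel_projection_add_transpose_eq_iff[OF surj_A])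

lemma G_x0: "G x0 = target 0"
  by (simp add: G_eq_target_iff x0_affine)

text \<open>Equal constraint values put \<open>x - y\<close> into the kernel, where equality of
  projected gradients can be tested as equality of gradients; monotonicity concludes.\<close>

lemma inj_on_G: "inj_on G C"
proof (rule inj_onI)
  fix x y assume xy: "x \<in> C" "y \<in> C" "G x = G y"
  then have "projA (barrier_gradient x) = projA (barrier_gradient y)" "A *v x = A *v y"
    unfolding G_def kernel_projection_add_transpose_eq_iff[OF surj_A] by auto
  moreover from this(2) have "A *v (x - y) = 0" by (simp add: matrix_vector_mult_diff_distrib)
  ultimately have "barrier_gradient x \<bullet> (x - y) = barrier_gradient y \<bullet> (x - y)"
    using projA_eq_imp_inner_eq by blast
  then show "x = y" by (intro barrier_gradient_monotone[OF xy(1,2)]) (simp add: inner_diff_left)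
qed

lemma linear_transpose_mult: "linear (\<lambda>u. (A *v u) v* A)"
proof -
  have "(\<lambda>u. (A *v u) v* A) = (*v) (transpose A ** A)"
    by (simp add: fun_eq_iff matrix_vector_mul_assoc[symmetric])
  then show ?thesis by simp
qed

lemma G_has_derivative:
  assumes "x \<in> C"
  shows "(G has_derivative dG x) (at x)"
  unfolding G_def[abs_def] dG_def[abs_def]
  using linear_projA
  by (intro has_derivative_add linear_imp_has_derivative[OF linear_transpose_mult]
      bounded_linear.has_derivative[OF _ barrier_gradient_has_derivative[OF assms]])
    (simp add: linear_conv_bounded_linear)

lemma continuous_on_G: "continuous_on C G"
  by (intro continuous_at_imp_continuous_on ballI has_derivative_continuous[OF G_has_derivative])

text \<open>The linearized form of the injectivity argument, with the positive definite Hessian in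
  place of the monotone gradient.\<close>

lemma dG_eq_0:
  assumes "x \<in> C" "dG x u = 0"
  shows "u = 0"
proof (rule ccontr)
  assume "u \<noteq> 0"
  have "projA (barrier_hessian x u) + (A *v u) v* A = projA 0 + 0 v* A"
    using assms(2) linear_0[OF linear_projA] by (simp add: dG_def)
  then have "projA (barrier_hessian x u) = projA 0" "A *v u = 0"
    unfolding kernel_projection_add_transpose_eq_iff[OF surj_A] by auto
  then have "barrier_hessian x u \<bullet> u = 0" using projA_eq_imp_inner_eq[of _ 0 u] by simp
  then show False using barrier_hessian_pos[OF assms(1) \<open>u \<noteq> 0\<close>] by simp
qed

lemma gradient_linear: "gradient (\<lambda>x. c \<bullet> x) y = c"
  using bounded_linear_imp_has_derivative[OF bounded_linear_inner_right[of c]]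
  by (intro gradient_eqI) (simp add: gderiv_def inner_commute[of _ c])

abbreviation "rgrad \<equiv> riemannian_gradient A h (\<lambda>x. c \<bullet> x)"

text \<open>In the coordinates given by \<open>G\<close> the vector field is constant, which is why
  its trajectories become straight lines.\<close>

lemma dG_riemannian_gradient:
  assumes "x \<in> C"
  shows "dG x (rgrad x) = projA c"
proof -
  have pos: "0 < u \<bullet> (hessian (finite_part h) x *v u)" if "u \<noteq> 0" for u
    using barrier_hessian_pos[OF assms that] by (simp add: hessian_barrier[OF assms] inner_commute)
  obtain v where "barrier_hessian x (rgrad x) = c - v v* A"
    using riemannian_gradient_characterization(2)[OF surj_A pos, of "\<lambda>x. c \<bullet> x"]
    by (auto simp: hessian_barrier[OF assms] gradient_linear)
  then show ?thesis
    using riemannian_gradient_characterization(1)[OF surj_A pos]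
    by (simp add: dG_def linear_diff[OF linear_projA] kernel_projection_transpose[OF surj_A])
qed

section \<open>The curve obtained by inverting \<open>G\<close> along the line\<close>

lemma open_G_image: "open (G ` C)"
  by (rule invariance_of_domain[OF continuous_on_G open_LP_open_set inj_on_G])

definition times :: "real set" where
  "times = {t. target t \<in> G ` C}"

text \<open>Meaningful only for \<open>t \<in> times\<close>; elsewhere \<open>inv_into\<close>
  returns an arbitrary value.\<close>

definition central_path :: "real \<Rightarrow> real^'n" where
  "central_path t = inv_into C G (target t)"

lemma target_eq: "target t = target 0 - t *\<^sub>R projA c"
  by (simp add: target_def linear_diff[OF linear_projA] linear_scale[OF linear_projA])

lemma target_has_vector_derivative: "(target has_vector_derivative - projA c) (at t)"
proof -
  have "((\<lambda>t. target 0 - t *\<^sub>R projA c) has_vector_derivative - projA c) (at t)"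
    by (auto intro!: derivative_eq_intros)
  then show ?thesis by (simp add: target_eq[symmetric])
qed

lemma continuous_on_target: "continuous_on T target"
  by (intro continuous_at_imp_continuous_on ballI
      has_vector_derivative_continuous[OF target_has_vector_derivative])

lemma open_times: "open times"
proof -
  have "times = target -` (G ` C)" by (auto simp: times_def)
  then show ?thesis using open_vimage[OF open_G_image continuous_on_target] by simp
qed

lemma zero_in_times: "0 \<in> times"
  using G_x0 x0_open unfolding times_def by (metis imageI mem_Collect_eq)

lemma central_path_mem: "t \<in> times \<Longrightarrow> central_path t \<in> C"
  by (simp add: times_def central_path_def inv_into_into)

lemma G_central_path: "t \<in> times \<Longrightarrow> G (central_path t) = target t"
  by (simp add: times_def central_path_def f_inv_into_f)

lemma central_path_affine: "t \<in> times \<Longrightarrow> A *v central_path t = b"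
  using G_central_path G_eq_target_iff by blast

lemma central_path_eqI: "\<lbrakk>x \<in> C; G x = target t\<rbrakk> \<Longrightarrow> t \<in> times \<and> central_path t = x"
  unfolding times_def central_path_def
  by (metis (mono_tags) imageI inj_on_G inv_into_f_f mem_Collect_eq)

text \<open>The equation of the path tested with a direction in the kernel of \<open>A\<close>. The
  later estimates come from special choices of \<open>u\<close>.\<close>

lemma central_path_inner:
  assumes "t \<in> times" "A *v u = 0"
  shows "(\<Sum>i\<in>UNIV. (\<psi> (g i (central_path t)) - \<psi> (g i x0)) * (B $ i \<bullet> u)) = - t * (c \<bullet> u)"
proof -
  have "barrier_gradient (central_path t) \<bullet> u = (barrier_gradient x0 - t *\<^sub>R c) \<bullet> u"
    using assms projA_eq_imp_inner_eq G_central_path G_eq_target_iff by blast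
  then show ?thesis
    by (simp add: inner_diff_left barrier_gradient_inner left_diff_distrib sum_subtractf)
qed

text \<open>By the inverse function theorem and the chain rule the derivative is the inverse of
  \<open>dG x\<close> applied to \<open>- projA c\<close>, and \<open>dG_riemannian_gradient\<close>
  identifies this vector.\<close>

lemma central_path_has_vector_derivative:
  assumes t: "t \<in> times"
  shows "(central_path has_vector_derivative - rgrad (central_path t)) (at t)"
proof -
  define x where "x = central_path t"
  have x: "x \<in> C" "G x = target t" using central_path_mem G_central_path t by (auto simp: x_def)
  have lin: "linear (dG x)" using G_has_derivative[OF x(1)] by (rule has_derivative_linear)
  then have "inj (dG x)" using dG_eq_0[OF x(1)] by (simp add: linear_injective_0)
  then obtain k where k: "linear k" "\<And>u. k (dG x u) = u" "\<And>u. dG x (k u) = u"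
    using linear_injective_isomorphism[OF lin] by blast
  have "(inv_into C G has_derivative k) (at (G x))"
    by (rule has_derivative_inverse_strong[OF open_LP_open_set x(1) continuous_on_G _ G_has_derivative[OF x(1)]])
      (auto simp: inj_on_G k)
  then have "((\<lambda>t. inv_into C G (target t)) has_vector_derivative k (- projA c)) (at t)"
    using vector_derivative_diff_chain_within[OF target_has_vector_derivative, of "inv_into C G" k t]
    by (simp add: x(2) has_derivative_at_withinI comp_def)
  moreover have "k (- projA c) = - rgrad x"
    using k(1,2) by (simp add: linear_neg dG_riemannian_gradient[OF x(1), symmetric])
  ultimately show ?thesis by (simp add: central_path_def[abs_def] x_def)
qed

section \<open>Uniqueness and maximality of solutions\<close>

abbreviation "solution \<equiv> HSD_solution C A b h (\<lambda>x. c \<bullet> x) x0"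
abbreviation "maximal_solution \<equiv> HSD_maximal_solution C A b h (\<lambda>x. c \<bullet> x) x0"

lemma central_path_0: "central_path 0 = x0"
  using central_path_eqI[OF x0_open G_x0] by simp

lemma central_path_solution:
  assumes "Tm < 0" "0 < TM" "einterval Tm TM \<subseteq> times"
  shows "solution Tm TM central_path"
  using assms central_path_0 central_path_mem central_path_affine central_path_has_vector_derivative
  unfolding HSD_solution_def by blast

text \<open>Along any solution \<open>G\<close> moves on a straight line at constant speed.\<close>
lemma solution_eq_central_path:
  assumes sol: "solution Tm TM y" and t: "t \<in> einterval Tm TM"
  shows "t \<in> times \<and> y t = central_path t"
proof -
  have y: "y s \<in> C" "(y has_vector_derivative - rgrad (y s)) (at s)"
    if "s \<in> einterval Tm TM" for s
    using sol that unfolding HSD_solution_def by auto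
  have "((\<lambda>s. G (y s) - target s) has_derivative (\<lambda>h. 0)) (at s within einterval Tm TM)"
    if s: "s \<in> einterval Tm TM" for s
  proof -
    have "linear (dG (y s))" using G_has_derivative[OF y(1)[OF s]] by (rule has_derivative_linear)
    then have "dG (y s) (- rgrad (y s)) = - projA c"
      by (simp add: linear_neg dG_riemannian_gradient[OF y(1)[OF s]])
    moreover have "((G \<circ> y) has_vector_derivative dG (y s) (- rgrad (y s))) (at s)"
      using vector_derivative_diff_chain_within[OF y(2)[OF s], of G "dG (y s)"]
      by (simp add: has_derivative_at_withinI G_has_derivative[OF y(1)[OF s]])
    ultimately have "((\<lambda>s. G (y s) - target s) has_vector_derivative 0) (at s)"
      using has_vector_derivative_diff[OF _ target_has_vector_derivative, of "G \<circ> y" _ s] by fastforce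
    then show ?thesis by (simp add: has_vector_derivative_def has_derivative_at_withinI)
  qed
  moreover have "convex (einterval Tm TM)"
    unfolding is_interval_convex_1[symmetric] is_interval_1
  proof (intro ballI allI impI)
    fix p q r assume "p \<in> einterval Tm TM" "q \<in> einterval Tm TM" "p \<le> r \<and> r \<le> q"
    then have "Tm < ereal p" "ereal p \<le> ereal r" "ereal r \<le> ereal q" "ereal q < TM"
      by (auto simp: einterval_iff)
    then show "r \<in> einterval Tm TM" unfolding einterval_iff
      by (blast intro: less_le_trans le_less_trans)
  qed
  moreover have "0 \<in> einterval Tm TM"
    using sol by (auto simp: HSD_solution_def einterval_iff zero_ereal_def)
  ultimately have "G (y t) - target t = G (y 0) - target 0"
    using has_derivative_zero_unique[of "einterval Tm TM" "\<lambda>s. G (y s) - target s" t 0] t by blast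
  also have "\<dots> = 0" using sol G_x0 by (simp add: HSD_solution_def)
  finally show ?thesis using central_path_eqI[OF y(1)[OF t], of t] by simp
qed

lemma well_posedI:
  assumes times: "{0..} \<subseteq> times"
  shows "HSD_well_posed C A b h (\<lambda>x. c \<bullet> x) x0"
    and "maximal_solution Sm SM y \<Longrightarrow> SM = \<infinity> \<and> (\<forall>t\<ge>0. y t = central_path t)"
proof -
  \<comment> \<open>The left end of the component of \<open>times\<close> containing 0, possibly
    minus infinity.\<close>
  define Tm where "Tm = Inf {ereal s |s. {s..0} \<subseteq> times}"
  obtain e where e: "e > 0" "ball 0 e \<subseteq> times" using open_times zero_in_times by (meson open_contains_ball)
  have "{-e/2..0} \<subseteq> ball 0 e" using e(1) by (auto simp: dist_real_def)
  then have "Tm \<le> ereal (-e/2)" unfolding Tm_def using e(2) by (intro Inf_lower) blast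
  also have "ereal (-e/2) < 0" using e(1) by simp
  finally have Tm: "Tm < 0" .
  have sub: "einterval Tm \<infinity> \<subseteq> times"
  proof
    fix t assume "t \<in> einterval Tm \<infinity>"
    then have "Tm < ereal t" by (simp add: einterval_iff)
    then obtain s where "{s..0} \<subseteq> times" "s < t" unfolding Tm_def by (auto simp: Inf_less_iff)
    then show "t \<in> times" using times by (cases "t \<ge> 0") auto
  qed
  have path: "solution Tm \<infinity> central_path"
    by (rule central_path_solution[OF Tm _ sub]) simp
  \<comment> \<open>A solution reaching further left would put an interval \<open>{s..0}\<close>
    with \<open>s < Tm\<close> into \<open>times\<close>.\<close>
  have left: "Tm \<le> Sm" if sol: "solution Sm SM y" for Sm SM y
  proof (rule ccontr)
    assume "\<not> Tm \<le> Sm"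
    then obtain s where s: "Sm < ereal s" "ereal s < Tm" using ereal_dense2[of Sm Tm] by (auto simp: not_le)
    have "0 < SM" using sol by (simp add: HSD_solution_def)
    have "{s..0} \<subseteq> einterval Sm SM"
    proof
      fix r assume "r \<in> {s..0}"
      then have "ereal s \<le> ereal r" "ereal r \<le> 0" by (auto simp: zero_ereal_def)
      with s(1) \<open>0 < SM\<close> show "r \<in> einterval Sm SM"
        unfolding einterval_iff by (blast intro: less_le_trans le_less_trans)
    qed
    then have "{s..0} \<subseteq> times" using solution_eq_central_path[OF sol] by blast
    then have "Tm \<le> ereal s" unfolding Tm_def by (intro Inf_lower) blast
    then show False using s(2) by simp
  qed
  have max: "maximal_solution Tm \<infinity> central_path"
    unfolding HSD_maximal_solution_def using path left by (auto intro: antisym)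
  have unique: "Sm = Tm \<and> SM = \<infinity> \<and> (\<forall>t\<in>einterval Tm \<infinity>. y t = central_path t)"
    if m: "maximal_solution Sm SM y" for Sm SM y
  proof -
    have sol: "solution Sm SM y" using m by (simp add: HSD_maximal_solution_def)
    then have "\<forall>t\<in>einterval Sm SM. central_path t = y t" using solution_eq_central_path by metis
    \<comment> \<open>The path on the interval from \<open>Tm\<close> to infinity extends
      \<open>y\<close>, so maximality of \<open>y\<close> forces equal intervals.\<close>
    then have "Tm = Sm \<and> \<infinity> = SM"
      using m path left[OF sol] unfolding HSD_maximal_solution_def by (meson ereal_less_eq(1))
    then show ?thesis using solution_eq_central_path[OF sol] by blast
  qed
  show "HSD_well_posed C A b h (\<lambda>x. c \<bullet> x) x0"
    unfolding HSD_well_posed_def using max unique by blast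
  show "SM = \<infinity> \<and> (\<forall>t\<ge>0. y t = central_path t)" if "maximal_solution Sm SM y"
  proof -
    have "t \<in> einterval Tm \<infinity>" if "t \<ge> 0" for t
    proof -
      have "0 \<le> ereal t" using that by simp
      then have "Tm < ereal t" by (rule less_le_trans[OF Tm])
      then show ?thesis by (simp add: einterval_iff)
    qed
    then show ?thesis using unique[OF that] by blast
  qed
qed

end

section \<open>Global existence\<close>

text \<open>On the sphere of radius \<open>R\<close> around a minimizer, outside the minimizing set, the objective
  exceeds its minimum by some \<open>\<delta> > 0\<close>; by convexity this excess grows at least linearly beyond it.\<close>
lemma bounded_sublevel_if_bounded_minimizers:
  fixes F :: "'a::euclidean_space set"
  assumes F: "closed F" "convex F" and z: "z \<in> F" "\<And>x. x \<in> F \<Longrightarrow> c \<bullet> z \<le> c \<bullet> x"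
    and bd: "bounded {x \<in> F. c \<bullet> x = c \<bullet> z}"
  shows "bounded {x \<in> F. c \<bullet> x \<le> \<alpha>}"
proof -
  obtain R where R: "R > 0" "{x \<in> F. c \<bullet> x = c \<bullet> z} \<subseteq> ball z R"
    using bounded_subset_ballD[OF bd, of z] by auto
  define Q where "Q = F \<inter> sphere z R"
  have compact: "compact Q" unfolding Q_def by (intro closed_Int_compact F(1) compact_sphere)
  \<comment> \<open>The segment from \<open>z\<close> to \<open>x\<close> crosses the sphere at this
    point, which belongs to \<open>F\<close> by convexity.\<close>
  have in_Q: "z + (R / norm (x - z)) *\<^sub>R (x - z) \<in> Q" if x: "x \<in> F" "norm (x - z) \<ge> R" for x
  proof -
    have "R / norm (x - z) \<le> 1" "0 \<le> R / norm (x - z)" using x R(1) by (auto simp: divide_le_eq)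
    then have "(1 - R / norm (x - z)) *\<^sub>R z + (R / norm (x - z)) *\<^sub>R x \<in> F"
      by (intro convexD_alt[OF F(2) z(1) x(1)])
    then have "z + (R / norm (x - z)) *\<^sub>R (x - z) \<in> F" by (simp add: algebra_simps)
    then show ?thesis using R(1) x(2) by (auto simp: Q_def dist_norm)
  qed
  have "\<exists>K. \<forall>x\<in>F. c \<bullet> x \<le> \<alpha> \<longrightarrow> norm (x - z) \<le> K"
  proof (cases "Q = {}")
    case True
    then have "\<forall>x\<in>F. norm (x - z) \<le> R" using in_Q by force
    then show ?thesis by blast
  next
    case False
    have "continuous_on Q (\<lambda>x. c \<bullet> x)" by (intro continuous_intros)
    then obtain q where q: "q \<in> Q" "\<And>x. x \<in> Q \<Longrightarrow> c \<bullet> q \<le> c \<bullet> x"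
      using continuous_attains_inf[OF compact False] by blast
    define \<delta> where "\<delta> = c \<bullet> q - c \<bullet> z"
    \<comment> \<open>All minimizers lie in the open ball, whereas \<open>q\<close> lies on its
      boundary sphere.\<close>
    have "q \<notin> {x \<in> F. c \<bullet> x = c \<bullet> z}" using R(2) q(1) by (auto simp: Q_def)
    then have \<delta>: "\<delta> > 0" using q(1) z(2)[of q] by (auto simp: Q_def \<delta>_def)
    have "norm (x - z) \<le> max R (R * (\<alpha> - c \<bullet> z) / \<delta>)" if x: "x \<in> F" "c \<bullet> x \<le> \<alpha>" for x
    proof (cases "norm (x - z) \<ge> R")
      case True
      have "\<delta> \<le> R / norm (x - z) * (c \<bullet> x - c \<bullet> z)"
        using q(2)[OF in_Q[OF x(1) True]] by (simp add: \<delta>_def inner_add_right inner_diff_right)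
      also have "\<dots> \<le> R / norm (x - z) * (\<alpha> - c \<bullet> z)"
        using x(2) R(1) by (intro mult_left_mono) auto
      finally have "\<delta> * norm (x - z) \<le> R * (\<alpha> - c \<bullet> z)"
        using less_le_trans[OF R(1) True] by (simp add: pos_le_divide_eq)
      then show ?thesis using \<delta> by (simp add: field_simps le_max_iff_disj)
    qed simp
    then show ?thesis by blast
  qed
  then obtain K where "\<forall>x\<in>F. c \<bullet> x \<le> \<alpha> \<longrightarrow> norm (x - z) \<le> K" by blast
  then have "{x \<in> F. c \<bullet> x \<le> \<alpha>} \<subseteq> cball z K" by (auto simp: dist_norm norm_minus_commute)
  then show ?thesis using bounded_cball bounded_subset by blast
qed

section \<open>Convexity and closedness of the feasible and optimal sets\<close>

lemma slack_convex_comb: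
  "slack B d i ((1 - u) *\<^sub>R x + u *\<^sub>R y) = (1 - u) * slack B d i x + u * slack B d i y"
  by (simp add: slack_def inner_add_right algebra_simps)

lemma convex_LP_feasible: "convex (LP_feasible A b B d)"
  unfolding convex_alt
  by (auto simp: mem_LP_feasible_iff slack_convex_comb matrix_vector_right_distrib
      matrix_vector_mult_scaleR scaleR_left_distrib[symmetric])

lemma closed_LP_feasible: "closed (LP_feasible A b B d)"
proof -
  have "LP_feasible A b B d = (\<Inter>i. {x. 0 \<le> slack B d i x}) \<inter> {x. A *v x = b}"
    by (auto simp: mem_LP_feasible_iff)
  then show ?thesis
    by (auto intro!: closed_INT closed_Collect_le closed_Collect_eq continuous_on_slack
        continuous_intros linear_continuous_on simp: linear_linear)
qed

lemma mem_LP_solutions_iff: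
  "x \<in> LP_solutions c A b B d \<longleftrightarrow> x \<in> LP_feasible A b B d \<and> (\<forall>y\<in>LP_feasible A b B d. c \<bullet> x \<le> c \<bullet> y)"
  by (auto simp: LP_solutions_def is_arg_min_linorder)

lemma convex_LP_solutions: "convex (LP_solutions c A b B d)"
  unfolding convex_alt
proof (intro ballI allI impI)
  fix x y and u :: real
  assume xy: "x \<in> LP_solutions c A b B d" "y \<in> LP_solutions c A b B d" and u: "0 \<le> u \<and> u \<le> 1"
  then have "c \<bullet> x = c \<bullet> y" by (auto simp: mem_LP_solutions_iff intro: antisym)
  then have "c \<bullet> ((1 - u) *\<^sub>R x + u *\<^sub>R y) = c \<bullet> x"
    by (simp add: inner_add_right left_diff_distrib)
  then show "(1 - u) *\<^sub>R x + u *\<^sub>R y \<in> LP_solutions c A b B d"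
    using xy u convexD_alt[OF convex_LP_feasible, of x A b B d y u]
    by (auto simp: mem_LP_solutions_iff)
qed

context linear_program_barrier
begin

abbreviation "F \<equiv> LP_feasible A b B d"
abbreviation "I\<^sub>0 \<equiv> LP_always_active c A b B d"

lemma open_subset_feasible: "\<lbrakk>x \<in> C; A *v x = b\<rbrakk> \<Longrightarrow> x \<in> F"
  by (auto simp: mem_LP_feasible_iff mem_LP_open_set_iff less_imp_le)

text \<open>The level set at the optimal value is \<open>S\<close>, so boundedness of
  \<open>S\<close> spreads to all sublevel sets.\<close>

lemma bounded_sublevel: "bounded {x \<in> F. c \<bullet> x \<le> \<alpha>}"
proof -
  obtain z where z: "z \<in> S" using solution_exists by blast
  then have "{x \<in> F. c \<bullet> x = c \<bullet> z} = S"
    by (auto simp: mem_LP_solutions_iff intro: antisym)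
  then show ?thesis
    using z solutions_bounded
    by (intro bounded_sublevel_if_bounded_minimizers[OF closed_LP_feasible convex_LP_feasible, of z])
      (auto simp: mem_LP_solutions_iff)
qed

text \<open>As \<open>r\<close> approaches 0, \<open>\<psi> r\<close> tends to minus infinity while
  \<open>s - r\<close> stays above \<open>s / 2\<close>, so the product exceeds any bound. This
  turns an energy bound into a positive lower bound on a slack.\<close>

lemma psi_barrier:
  assumes "s > 0"
  obtains \<delta> where "\<delta> > 0" "\<And>r. \<lbrakk>0 < r; (\<psi> r - \<psi> s) * (r - s) \<le> M\<rbrakk> \<Longrightarrow> \<delta> \<le> r"
proof -
  \<comment> \<open>A nonnegative bound makes \<open>(2 * M' + 2) / s\<close> nonnegative, hence
    \<open>\<psi> r \<le> \<psi> s\<close>; multiplied by \<open>s / 2\<close> the constant becomes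
    \<open>M' + 1\<close>, which exceeds \<open>M\<close>.\<close>
  define M' where "M' = max M 0"
  have "\<forall>\<^sub>F r in at_right 0. \<psi> r \<le> \<psi> s - (2 * M' + 2) / s"
    using theta_deriv_lim by (simp add: filterlim_at_bot)
  then obtain e where e: "e > 0" "\<And>r. \<lbrakk>0 < r; r < e\<rbrakk> \<Longrightarrow> \<psi> r \<le> \<psi> s - (2 * M' + 2) / s"
    by (auto simp: eventually_at_right_field)
  show thesis
  proof (rule that[of "min e (s / 2)"])
    fix r assume r: "0 < r" "(\<psi> r - \<psi> s) * (r - s) \<le> M"
    show "min e (s / 2) \<le> r"
    proof (rule ccontr)
      assume "\<not> ?thesis"
      then have lt: "r < e" "r < s / 2" by auto
      have "0 \<le> (2 * M' + 2) / s" using assms by (simp add: M'_def)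
      then have psi: "\<psi> r \<le> \<psi> s" using e(2)[OF r(1) lt(1)] by simp
      have "M < (2 * M' + 2) / s * (s / 2)" using assms by (simp add: M'_def)
      also have "\<dots> \<le> (\<psi> s - \<psi> r) * (s - r)"
        using e(2)[OF r(1) lt(1)] lt(2) assms psi by (intro mult_mono) auto
      also have "\<dots> = (\<psi> r - \<psi> s) * (r - s)" by (simp add: algebra_simps)
      finally show False using r(2) by simp
    qed
  qed (use e assms in auto)
qed

text \<open>The path identity tested with the displacement from \<open>x0\<close>.\<close>

lemma central_path_energy:
  assumes "t \<in> times"
  shows "(\<Sum>i\<in>UNIV. (\<psi> (g i (central_path t)) - \<psi> (g i x0)) * (g i (central_path t) - g i x0))
    = t * (c \<bullet> x0 - c \<bullet> central_path t)"
proof -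
  have "A *v (central_path t - x0) = 0"
    by (simp add: matrix_vector_mult_diff_distrib central_path_affine[OF assms] x0_affine)
  from central_path_inner[OF assms this] show ?thesis
    by (simp add: slack_diff inner_diff_right algebra_simps)
qed

lemma central_path_objective_le:
  assumes "t \<in> times" "t \<ge> 0"
  shows "c \<bullet> central_path t \<le> c \<bullet> x0"
proof (cases "t = 0")
  case False
  have "0 \<le> t * (c \<bullet> x0 - c \<bullet> central_path t)"
    unfolding central_path_energy[OF assms(1), symmetric]
    using central_path_mem[OF assms(1)] x0_open
    by (intro sum_nonneg psi_diff_mult_nonneg slack_pos)
  then show ?thesis using False assms(2) by (simp add: zero_le_mult_iff)
qed (simp add: central_path_0)

lemma central_path_feasible: "t \<in> times \<Longrightarrow> central_path t \<in> F"
  by (intro open_subset_feasible central_path_mem central_path_affine)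

text \<open>Up to time \<open>N\<close> the energy is at most \<open>M\<close>, because the
  objective never drops below its optimum. Its terms are nonnegative, so each is at most
  \<open>M\<close>, and \<open>psi_barrier\<close> keeps every slack above some
  \<open>\<delta> i\<close>.\<close>

lemma central_path_compact:
  obtains K where "compact K" "K \<subseteq> C" "\<And>t. \<lbrakk>t \<in> times; 0 \<le> t; t \<le> N\<rbrakk> \<Longrightarrow> central_path t \<in> K"
proof -
  obtain z where z: "z \<in> S" using solution_exists by blast
  define M where "M = N * (c \<bullet> x0 - c \<bullet> z)"
  have "\<exists>\<delta>>0. \<forall>r. 0 < r \<longrightarrow> (\<psi> r - \<psi> (g i x0)) * (r - g i x0) \<le> M \<longrightarrow> \<delta> \<le> r" for i
    using psi_barrier[OF slack_pos[OF x0_open], of i M] by metis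
  then obtain \<delta> where \<delta>: "\<And>i. \<delta> i > 0"
    "\<And>i r. \<lbrakk>0 < r; (\<psi> r - \<psi> (g i x0)) * (r - g i x0) \<le> M\<rbrakk> \<Longrightarrow> \<delta> i \<le> r" by metis
  define K where "K = {x \<in> F. c \<bullet> x \<le> c \<bullet> x0} \<inter> (\<Inter>i. {x. \<delta> i \<le> g i x})"
  have "closed {x \<in> F. c \<bullet> x \<le> c \<bullet> x0}"
    using closed_Int[OF closed_LP_feasible closed_halfspace_le] by (simp add: Collect_conj_eq)
  then have "compact {x \<in> F. c \<bullet> x \<le> c \<bullet> x0}"
    using bounded_sublevel compact_eq_bounded_closed by blast
  then have "compact K" unfolding K_def
    by (intro compact_Int_closed closed_INT ballI closed_Collect_le continuous_on_slack continuous_intros)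
  moreover have "K \<subseteq> C" using \<delta>(1) by (fastforce simp: K_def mem_LP_open_set_iff intro: less_le_trans)
  moreover have "central_path t \<in> K" if t: "t \<in> times" "0 \<le> t" "t \<le> N" for t
  proof -
    define x where "x = central_path t"
    have x: "x \<in> C" "x \<in> F" "c \<bullet> x \<le> c \<bullet> x0"
      using t central_path_mem central_path_feasible central_path_objective_le by (auto simp: x_def)
    have "c \<bullet> z \<le> c \<bullet> x" using z x(2) by (simp add: mem_LP_solutions_iff)
    then have le_M: "t * (c \<bullet> x0 - c \<bullet> x) \<le> M" unfolding M_def using t x(3) by (intro mult_mono) auto
    have "\<delta> i \<le> g i x" for i
    proof (rule \<delta>(2)[OF slack_pos[OF x(1)]])
      have "(\<psi> (g i x) - \<psi> (g i x0)) * (g i x - g i x0)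
          \<le> (\<Sum>i\<in>UNIV. (\<psi> (g i x) - \<psi> (g i x0)) * (g i x - g i x0))"
        by (rule member_le_sum) (use x(1) x0_open in \<open>auto intro!: psi_diff_mult_nonneg slack_pos\<close>)
      also have "\<dots> \<le> M" using le_M central_path_energy[OF t(1)] by (simp add: x_def)
      finally show "(\<psi> (g i x) - \<psi> (g i x0)) * (g i x - g i x0) \<le> M" .
    qed
    then show ?thesis using x by (simp add: K_def x_def)
  qed
  ultimately show thesis by (rule that)
qed

text \<open>On \<open>{0..N}\<close> the open set \<open>times\<close> coincides with a closed set,
  the times whose target lies in the image of the compact set \<open>K\<close>. As it contains 0,
  connectedness of the interval gives all of it.\<close>

lemma nonneg_subset_times: "{0..} \<subseteq> times"
proof
  fix N :: real assume "N \<in> {0..}"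
  then have N: "0 \<le> N" by simp
  obtain K where K: "compact K" "K \<subseteq> C" "\<And>t. \<lbrakk>t \<in> times; 0 \<le> t; t \<le> N\<rbrakk> \<Longrightarrow> central_path t \<in> K"
    using central_path_compact[of N] by blast
  have "compact (G ` K)" using continuous_on_subset[OF continuous_on_G K(2)] K(1) by (rule compact_continuous_image)
  then have closed: "closed (target -` (G ` K))"
    using continuous_on_target by (intro closed_vimage compact_imp_closed)
  have inside: "target -` (G ` K) \<subseteq> times" using K(2) by (auto simp: times_def)
  have cover: "{0..N} \<inter> times \<subseteq> target -` (G ` K)"
  proof
    fix t assume "t \<in> {0..N} \<inter> times"
    then have "central_path t \<in> K" "target t = G (central_path t)"
      using K(3) G_central_path by auto
    then show "t \<in> target -` (G ` K)" by auto
  qed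
  have "times \<inter> {0..N} = {} \<or> - (target -` (G ` K)) \<inter> {0..N} = {}"
    by (rule connectedD[OF connected_Icc open_times])
      (use closed inside cover in \<open>auto simp: open_closed\<close>)
  moreover have "0 \<in> times \<inter> {0..N}" using zero_in_times N by simp
  ultimately have "N \<in> target -` (G ` K)" using N by auto
  then show "N \<in> times" using inside by blast
qed

section \<open>Convergence\<close>

lemma theta_above_tangent:
  assumes "0 < l" "0 < r" "r \<noteq> l"
  shows "finite_part \<theta> l + \<psi> l * (r - l) < finite_part \<theta> r"
proof (cases "l < r")
  case True
  then obtain z where z: "l < z" "finite_part \<theta> r - finite_part \<theta> l = (r - l) * \<psi> z"
    using MVT2[OF True, of "finite_part \<theta>" \<psi>] DERIV_theta assms by force
  have "(r - l) * \<psi> l < (r - l) * \<psi> z" using True psi_less[OF assms(1) z(1)] by simp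
  then show ?thesis using z(2) by (simp add: mult.commute)
next
  case False
  then have "r < l" using assms(3) by simp
  then obtain z where z: "r < z" "z < l" "finite_part \<theta> l - finite_part \<theta> r = (l - r) * \<psi> z"
    using MVT2[of r l "finite_part \<theta>" \<psi>] DERIV_theta assms by force
  have "(l - r) * \<psi> z < (l - r) * \<psi> l" using \<open>r < l\<close> psi_less[of z l] z assms by simp
  then show ?thesis using z(3) by (simp add: algebra_simps)
qed

text \<open>The boundary value is compared with the midpoint \<open>l / 2\<close>, where the strict tangent inequality holds.\<close>
lemma theta_0_above_tangent:
  assumes "0 < l" "\<theta> 0 = ereal a"
  shows "finite_part \<theta> l + \<psi> l * (0 - l) < a"
proof -
  have "convex {(x, r::real). \<theta> x \<le> ereal r}"
    using theta_Gamma0 by (simp add: Gamma0_def convex_ereal_def)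
  then have "(1 - 1/2) *\<^sub>R (0, a) + (1/2) *\<^sub>R (l, finite_part \<theta> l) \<in> {(x, r::real). \<theta> x \<le> ereal r}"
    using assms theta_finite[OF assms(1)] by (intro convexD_alt) auto
  then have "\<theta> (l / 2) \<le> ereal (a / 2 + finite_part \<theta> l / 2)" by simp
  then have "finite_part \<theta> (l / 2) \<le> a / 2 + finite_part \<theta> l / 2"
    using theta_finite[of "l / 2"] assms by (metis ereal_less_eq(3) half_gt_zero)
  moreover have "finite_part \<theta> l + \<psi> l * (l / 2 - l) < finite_part \<theta> (l / 2)"
    using assms by (intro theta_above_tangent) auto
  ultimately show ?thesis by (simp add: algebra_simps)
qed

lemma bregman_finite:
  "\<lbrakk>0 < l; 0 < s\<rbrakk> \<Longrightarrow> bregman \<theta> l s = ereal (finite_part \<theta> l - finite_part \<theta> s - \<psi> s * (l - s))"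
  by (simp add: bregman_def theta_finite[of l] theta_finite[of s])

text \<open>\<open>\<psi> l - \<psi> s\<close> is the slope at \<open>l\<close> of the distance in
  its first argument. An infinite value of \<theta> and the endpoint \<open>r = 0\<close> are
  handled separately.\<close>

lemma bregman_above_tangent:
  assumes "0 < l" "0 < s" "0 \<le> r" "r \<noteq> l"
  shows "bregman \<theta> l s + ereal ((\<psi> l - \<psi> s) * (r - l)) < bregman \<theta> r s"
proof -
  have "\<theta> r \<noteq> -\<infinity>" using theta_Gamma0 by (simp add: Gamma0_def proper_def)
  then consider (infinite) "\<theta> r = \<infinity>" | (finite) a where "\<theta> r = ereal a" by (cases "\<theta> r") auto
  then show ?thesis
  proof cases
    case infinite
    then have "bregman \<theta> r s = \<infinity>" by (simp add: bregman_def theta_finite[OF assms(2)])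
    then show ?thesis by (simp add: bregman_finite[OF assms(1,2)])
  next
    case (finite a)
    have "finite_part \<theta> l + \<psi> l * (r - l) < a"
    proof (cases "r = 0")
      case True
      then show ?thesis using theta_0_above_tangent[OF assms(1)] finite by blast
    next
      case False
      then show ?thesis
        using theta_above_tangent[OF assms(1) _ assms(4)] assms(3) finite by (simp add: finite_part_def)
    qed
    then have "finite_part \<theta> l - finite_part \<theta> s - \<psi> s * (l - s) + (\<psi> l - \<psi> s) * (r - l)
        < a - finite_part \<theta> s - \<psi> s * (r - s)" by (simp add: algebra_simps)
    then show ?thesis unfolding bregman_finite[OF assms(1,2)]
      by (simp add: bregman_def finite theta_finite[OF assms(2)])
  qed
qed

lemma slack_solution_nonneg: "x \<in> S \<Longrightarrow> 0 \<le> g i x"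
  by (simp add: mem_LP_solutions_iff mem_LP_feasible_iff)

lemma slack_always_active: "\<lbrakk>i \<in> I\<^sub>0; x \<in> S\<rbrakk> \<Longrightarrow> g i x = 0"
  by (simp add: LP_always_active_def)

text \<open>Slacks are affine and nonnegative on \<open>S\<close>, so the midpoint of a solution
  positive on \<open>J\<close> and one positive at \<open>j\<close> is positive on both.\<close>

lemma solution_with_positive_slacks:
  obtains z where "z \<in> S" "\<And>i. i \<notin> I\<^sub>0 \<Longrightarrow> 0 < g i z"
proof -
  have "\<exists>z\<in>S. \<forall>i\<in>J. 0 < g i z" if "finite J" "J \<subseteq> - I\<^sub>0" for J
    using that
  proof (induction J)
    case empty
    then show ?case using solution_exists by blast
  next
    case (insert j J)
    then obtain z where z: "z \<in> S" "\<forall>i\<in>J. 0 < g i z" by auto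
    have "j \<notin> I\<^sub>0" using insert.prems by simp
    then obtain y where y: "y \<in> S" "g j y \<noteq> 0" by (auto simp: LP_always_active_def)
    define w where "w = (1 - 1/2) *\<^sub>R z + (1/2) *\<^sub>R y"
    have "w \<in> S" unfolding w_def by (intro convexD_alt[OF convex_LP_solutions z(1) y(1)]) auto
    moreover have "g i w = g i z / 2 + g i y / 2" for i
      unfolding w_def slack_convex_comb by simp
    then have "0 < g i w" if "i \<in> insert j J" for i
      using that slack_solution_nonneg[OF z(1), of i] slack_solution_nonneg[OF y(1), of i] y(2) z(2)
      by (cases "i = j") (auto simp: add_pos_nonneg add_nonneg_pos)
    ultimately show ?case by blast
  qed
  from this[of "- I\<^sub>0"] that show thesis by auto
qed

text \<open>Directions between two solutions are tangent to the objective and to the always active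
  constraints, so neither the time nor the singular part of the barrier gradient contributes.\<close>
lemma central_path_solution_directions:
  assumes "t \<in> times" "y \<in> S" "y' \<in> S"
  shows "(\<Sum>i\<in>- I\<^sub>0. (\<psi> (g i (central_path t)) - \<psi> (g i x0)) * (g i y - g i y')) = 0"
proof -
  have "A *v (y - y') = 0" "c \<bullet> (y - y') = 0"
    using assms(2,3) by (auto simp: mem_LP_solutions_iff mem_LP_feasible_iff inner_diff_right
        matrix_vector_mult_diff_distrib intro: antisym)
  then have "(\<Sum>i\<in>UNIV. (\<psi> (g i (central_path t)) - \<psi> (g i x0)) * (g i y - g i y')) = 0"
    using central_path_inner[OF assms(1), of "y - y'"] by (simp add: slack_diff)
  also have "(\<Sum>i\<in>UNIV. (\<psi> (g i (central_path t)) - \<psi> (g i x0)) * (g i y - g i y'))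
      = (\<Sum>i\<in>- I\<^sub>0. (\<psi> (g i (central_path t)) - \<psi> (g i x0)) * (g i y - g i y'))"
    by (rule sum.mono_neutral_right) (auto simp: slack_always_active[OF _ assms(2)] slack_always_active[OF _ assms(3)])
  finally show ?thesis .
qed

section \<open>Boundedness of the path and convergence of the objective\<close>

lemma bounded_central_path: "bounded (central_path ` {0..})"
  by (rule bounded_subset[OF bounded_sublevel[of "c \<bullet> x0"]])
    (use nonneg_subset_times in \<open>auto intro!: central_path_feasible central_path_objective_le\<close>)

text \<open>Testing with \<open>y - x\<close>, monotonicity of \<open>\<psi>\<close> replaces the
  possibly unbounded \<open>\<psi> (g i x)\<close> by the fixed \<open>\<psi> (g i y)\<close>;
  boundedness of the path controls the other factor.\<close>

lemma central_path_objective_near: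
  assumes y: "y \<in> C" "A *v y = b"
  obtains M where "\<And>t. 0 < t \<Longrightarrow> c \<bullet> central_path t - c \<bullet> y \<le> M / t"
proof -
  obtain R where R: "\<And>t. 0 \<le> t \<Longrightarrow> norm (central_path t) \<le> R"
    using bounded_central_path by (auto simp: bounded_iff)
  define M where "M = (\<Sum>i\<in>UNIV. \<bar>\<psi> (g i y) - \<psi> (g i x0)\<bar> * (norm (B $ i) * (norm y + R)))"
  show thesis
  proof (rule that)
    fix t :: real assume t: "0 < t"
    then have times: "t \<in> times" using nonneg_subset_times by auto
    define x where "x = central_path t"
    have x: "x \<in> C" "A *v x = b" using central_path_mem central_path_affine times by (auto simp: x_def)
    have "A *v (y - x) = 0" using x y by (simp add: matrix_vector_mult_diff_distrib)
    then have "t * (c \<bullet> x - c \<bullet> y) = (\<Sum>i\<in>UNIV. (\<psi> (g i x) - \<psi> (g i x0)) * (B $ i \<bullet> (y - x)))"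
      using central_path_inner[OF times, of "y - x"] by (simp add: x_def inner_diff_right algebra_simps)
    also have "\<dots> \<le> M" unfolding M_def
    proof (rule sum_mono)
      fix i
      have "0 \<le> (\<psi> (g i y) - \<psi> (g i x)) * (g i y - g i x)"
        using x y by (intro psi_diff_mult_nonneg slack_pos)
      then have "(\<psi> (g i x) - \<psi> (g i x0)) * (B $ i \<bullet> (y - x))
          \<le> (\<psi> (g i y) - \<psi> (g i x0)) * (B $ i \<bullet> (y - x))"
        by (simp add: slack_diff algebra_simps)
      also have "\<dots> \<le> \<bar>\<psi> (g i y) - \<psi> (g i x0)\<bar> * \<bar>B $ i \<bullet> (y - x)\<bar>"
        by (simp add: abs_mult[symmetric])
      also have "\<bar>B $ i \<bullet> (y - x)\<bar> \<le> norm (B $ i) * norm (y - x)"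
        by (rule Cauchy_Schwarz_ineq2)
      also have "norm (y - x) \<le> norm y + R"
        using norm_triangle_ineq4[of y x] R[of t] t by (simp add: x_def)
      finally show "(\<psi> (g i x) - \<psi> (g i x0)) * (B $ i \<bullet> (y - x))
          \<le> \<bar>\<psi> (g i y) - \<psi> (g i x0)\<bar> * (norm (B $ i) * (norm y + R))"
        by (simp add: mult_left_mono)
    qed
    finally show "c \<bullet> central_path t - c \<bullet> y \<le> M / t"
      using t by (simp add: x_def field_simps)
  qed
qed

text \<open>An optimal \<open>z\<close> may have vanishing slacks, so the estimate of order 1/t is
  applied to a strictly feasible point between \<open>z\<close> and \<open>x0\<close>.\<close>

lemma central_path_objective_tendsto:
  assumes z: "z \<in> S"
  shows "((\<lambda>t. c \<bullet> central_path t) \<longlongrightarrow> c \<bullet> z) at_top"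
proof (rule order_tendstoI)
  fix a assume "a < c \<bullet> z"
  moreover have "c \<bullet> z \<le> c \<bullet> central_path t" if "t \<ge> 0" for t
    using z central_path_feasible[of t] nonneg_subset_times that by (auto simp: mem_LP_solutions_iff)
  ultimately show "\<forall>\<^sub>F t in at_top. a < c \<bullet> central_path t"
    by (intro eventually_at_top_linorderI[of 0]) (auto intro: less_le_trans)
next
  fix a assume a: "c \<bullet> z < a"
  define v where "v = c \<bullet> x0 - c \<bullet> z"
  have "v \<ge> 0" using z open_subset_feasible[OF x0_open x0_affine] by (auto simp: v_def mem_LP_solutions_iff)
  \<comment> \<open>The objective at \<open>y\<close> exceeds its optimum by \<open>u * v\<close>,
    which must stay below \<open>a - c \<bullet> z\<close>. The summand 1 keeps the denominator
    positive when \<open>v = 0\<close>.\<close>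
  define u where "u = min 1 ((a - c \<bullet> z) / (2 * (v + 1)))"
  have u: "0 < u" "u \<le> 1" using a \<open>v \<ge> 0\<close> by (auto simp: u_def)
  have "u * v \<le> (a - c \<bullet> z) / (2 * (v + 1)) * v" using \<open>v \<ge> 0\<close> by (intro mult_right_mono) (auto simp: u_def)
  also have "\<dots> < a - c \<bullet> z"
  proof -
    have "(a - c \<bullet> z) * v < (a - c \<bullet> z) * (2 * (v + 1))" using a \<open>v \<ge> 0\<close> by simp
    then show ?thesis using \<open>v \<ge> 0\<close> by (simp add: field_simps)
  qed
  finally have uv: "u * v < a - c \<bullet> z" .
  define y where "y = (1 - u) *\<^sub>R z + u *\<^sub>R x0"
  have "y \<in> C" unfolding mem_LP_open_set_iff y_def slack_convex_comb
    using u slack_solution_nonneg[OF z] slack_pos[OF x0_open] by (simp add: add_nonneg_pos)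
  moreover have "A *v y = b" using z x0_affine
    by (simp add: y_def matrix_vector_right_distrib matrix_vector_mult_scaleR mem_LP_solutions_iff
        mem_LP_feasible_iff scaleR_left_distrib[symmetric])
  ultimately obtain M where M: "\<And>t. 0 < t \<Longrightarrow> c \<bullet> central_path t - c \<bullet> y \<le> M / t"
    using central_path_objective_near by metis
  have "c \<bullet> y = c \<bullet> z + u * v" by (simp add: y_def v_def inner_add_right algebra_simps)
  then have "c \<bullet> y < a" using uv by simp
  have "((\<lambda>t. c \<bullet> y + M / t) \<longlongrightarrow> c \<bullet> y + 0) at_top"
    by (intro tendsto_add tendsto_const real_tendsto_divide_at_top[OF tendsto_const] filterlim_ident)
  then have "\<forall>\<^sub>F t in at_top. c \<bullet> y + M / t < a"
    using \<open>c \<bullet> y < a\<close> by (intro order_tendstoD(2)) auto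
  then show "\<forall>\<^sub>F t in at_top. c \<bullet> central_path t < a"
    using eventually_gt_at_top[of 0]
    by eventually_elim (use M in \<open>force intro: le_less_trans\<close>)
qed

section \<open>Cluster points of the path at infinity\<close>

context
  fixes T :: "nat \<Rightarrow> real" and l :: "real^'n"
  assumes T_nonneg: "\<And>k. 0 \<le> T k" and T_lim: "filterlim T at_top sequentially"
    and path_lim: "(\<lambda>k. central_path (T k)) \<longlonglongrightarrow> l"
begin

private abbreviation (input) "X k \<equiv> central_path (T k)"

private lemma T_times: "T k \<in> times"
  using T_nonneg nonneg_subset_times by auto

private lemma slack_lim: "(\<lambda>k. g i (X k)) \<longlonglongrightarrow> g i l"
  unfolding slack_def by (intro tendsto_intros path_lim)

text \<open>The feasible set is closed, and the objective along the path has the optimal value as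
  its limit.\<close>

lemma cluster_point_optimal: "l \<in> S"
proof -
  obtain z where z: "z \<in> S" using solution_exists by blast
  have "l \<in> F"
    using closed_sequentially[OF closed_LP_feasible _ path_lim] central_path_feasible[OF T_times] by blast
  have "(\<lambda>k. c \<bullet> X k) \<longlonglongrightarrow> c \<bullet> l" by (intro tendsto_intros path_lim)
  moreover have "(\<lambda>k. c \<bullet> X k) \<longlonglongrightarrow> c \<bullet> z"
    using filterlim_compose[OF central_path_objective_tendsto[OF z] T_lim] .
  ultimately have "c \<bullet> l = c \<bullet> z" by (rule LIMSEQ_unique)
  then show ?thesis using z \<open>l \<in> F\<close> by (simp add: mem_LP_solutions_iff)
qed

text \<open>If a slack outside \<open>I\<^sub>0\<close> vanished in the limit, its term in
  \<open>central_path_solution_directions\<close> would tend to minus infinity, all others being bounded above.\<close>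
lemma cluster_point_slack_pos:
  assumes "j \<notin> I\<^sub>0"
  shows "0 < g j l"
proof (rule ccontr)
  assume "\<not> 0 < g j l"
  then have j0: "g j l = 0" using slack_solution_nonneg[OF cluster_point_optimal, of j] by simp
  obtain z where z: "z \<in> S" "\<And>i. i \<notin> I\<^sub>0 \<Longrightarrow> 0 < g i z" using solution_with_positive_slacks by blast
  define tm where "tm i k = (\<psi> (g i (X k)) - \<psi> (g i x0)) * (g i z - g i l)" for i k
  have singular: "\<forall>\<^sub>F k in sequentially. tm i k \<le> m" if "i \<notin> I\<^sub>0" "g i l = 0" for i m
  proof -
    have gz: "0 < g i z" using z(2) that(1) .
    have "filterlim (\<lambda>k. g i (X k)) (at_right 0) sequentially"
      using slack_lim[of i] that(2) slack_pos[OF central_path_mem[OF T_times]]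
      by (intro tendsto_imp_filterlim_at_right) auto
    then have "filterlim (\<lambda>k. \<psi> (g i (X k))) at_bot sequentially"
      by (rule filterlim_compose[OF theta_deriv_lim])
    then have "\<forall>\<^sub>F k in sequentially. \<psi> (g i (X k)) \<le> \<psi> (g i x0) + m / g i z"
      by (simp add: filterlim_at_bot)
    then show ?thesis
    proof eventually_elim
      case (elim k)
      then have "(\<psi> (g i (X k)) - \<psi> (g i x0)) * g i z \<le> m / g i z * g i z"
        using gz by (intro mult_right_mono) auto
      then show ?case using gz that(2) by (simp add: tm_def)
    qed
  qed
  have "\<exists>m. \<forall>\<^sub>F k in sequentially. tm i k \<le> m" if "i \<notin> I\<^sub>0" for i
  proof (cases "g i l = 0")
    case True
    then show ?thesis using singular[OF that] by blast
  next
    case False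
    then have "0 < g i l" using slack_solution_nonneg[OF cluster_point_optimal, of i] by simp
    then have "(\<lambda>k. \<psi> (g i (X k))) \<longlonglongrightarrow> \<psi> (g i l)"
      by (intro isCont_tendsto_compose[OF isCont_psi slack_lim])
    then have "tm i \<longlonglongrightarrow> (\<psi> (g i l) - \<psi> (g i x0)) * (g i z - g i l)"
      unfolding tm_def by (intro tendsto_intros)
    then have "\<forall>\<^sub>F k in sequentially. tm i k < (\<psi> (g i l) - \<psi> (g i x0)) * (g i z - g i l) + 1"
      by (rule order_tendstoD(2)) simp
    then show ?thesis by (blast intro: eventually_mono less_imp_le)
  qed
  then obtain m where m: "\<And>i. i \<notin> I\<^sub>0 \<Longrightarrow> \<forall>\<^sub>F k in sequentially. tm i k \<le> m i" by metis
  have "\<forall>\<^sub>F k in sequentially. \<forall>i\<in>- I\<^sub>0. tm i k \<le> m i"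
    using m by (intro eventually_ball_finite) auto
  \<comment> \<open>This bound outweighs the upper bounds \<open>m i\<close> of the other terms, so
    a sum known to be 0 would be at most -1.\<close>
  moreover have "\<forall>\<^sub>F k in sequentially. tm j k \<le> - 1 - (\<Sum>i\<in>- I\<^sub>0 - {j}. m i)"
    by (rule singular[OF assms j0])
  ultimately have "\<forall>\<^sub>F k in sequentially. False"
  proof eventually_elim
    case (elim k)
    have "0 = (\<Sum>i\<in>- I\<^sub>0. tm i k)"
      using central_path_solution_directions[OF T_times z(1) cluster_point_optimal] by (simp add: tm_def)
    also have "\<dots> = tm j k + (\<Sum>i\<in>- I\<^sub>0 - {j}. tm i k)" using assms by (simp add: sum.remove)
    also have "\<dots> \<le> - 1"
      using elim sum_mono[of "- I\<^sub>0 - {j}" "\<lambda>i. tm i k" m] by simp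
    finally show False by simp
  qed
  then show False by simp
qed

text \<open>Outside \<open>I\<^sub>0\<close> the limit slacks are positive, so \<open>\<psi>\<close>
  is continuous there and the identity passes to the limit.\<close>

lemma cluster_point_first_order:
  assumes "y \<in> S"
  shows "(\<Sum>i\<in>- I\<^sub>0. (\<psi> (g i l) - \<psi> (g i x0)) * (g i y - g i l)) = 0"
proof -
  have "(\<lambda>k. \<Sum>i\<in>- I\<^sub>0. (\<psi> (g i (X k)) - \<psi> (g i x0)) * (g i y - g i l))
      \<longlonglongrightarrow> (\<Sum>i\<in>- I\<^sub>0. (\<psi> (g i l) - \<psi> (g i x0)) * (g i y - g i l))"
    by (intro tendsto_intros isCont_tendsto_compose[OF isCont_psi slack_lim])
      (simp add: cluster_point_slack_pos)
  then show ?thesis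
    by (simp add: central_path_solution_directions[OF T_times assms cluster_point_optimal] LIMSEQ_const_iff)
qed

end

text \<open>The first-order condition of the Bregman problem. It is an equality because positive
  slacks outside \<open>I\<^sub>0\<close> place \<open>l\<close> in the relative interior of
  \<open>S\<close>.\<close>

definition bregman_stationary :: "real^'n \<Rightarrow> bool" where
  "bregman_stationary l \<longleftrightarrow> l \<in> S \<and> (\<forall>i\<in>- I\<^sub>0. 0 < g i l) \<and>
     (\<forall>y\<in>S. (\<Sum>i\<in>- I\<^sub>0. (\<psi> (g i l) - \<psi> (g i x0)) * (g i y - g i l)) = 0)"

lemma solution_eqI:
  assumes "x \<in> S" "y \<in> S" "\<And>i. i \<notin> I\<^sub>0 \<Longrightarrow> g i x = g i y"
  shows "x = y"
proof -
  have "g i x = g i y" for i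
    by (cases "i \<in> I\<^sub>0") (simp_all add: assms slack_always_active)
  then have "B $ i \<bullet> (x - y) = 0" for i by (simp flip: slack_diff[of B d])
  then show ?thesis using row_inner_eq_0[of "x - y"] by simp
qed

text \<open>Testing each condition with the other point and adding yields a vanishing sum of
  monotonicity terms.\<close>

lemma bregman_stationary_unique:
  assumes "bregman_stationary x" "bregman_stationary y"
  shows "x = y"
proof (rule solution_eqI)
  show xy: "x \<in> S" "y \<in> S" using assms by (auto simp: bregman_stationary_def)
  have pos: "0 < g i x" "0 < g i y" if "i \<in> - I\<^sub>0" for i
    using assms that by (auto simp: bregman_stationary_def)
  have "(\<Sum>i\<in>- I\<^sub>0. (\<psi> (g i x) - \<psi> (g i y)) * (g i x - g i y))
      = - (\<Sum>i\<in>- I\<^sub>0. (\<psi> (g i x) - \<psi> (g i x0)) * (g i y - g i x))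
        - (\<Sum>i\<in>- I\<^sub>0. (\<psi> (g i y) - \<psi> (g i x0)) * (g i x - g i y))"
    unfolding sum_negf[symmetric] sum_subtractf[symmetric] by (intro sum.cong) (auto simp: algebra_simps)
  also have "\<dots> = 0" using assms xy by (simp add: bregman_stationary_def)
  finally have "\<forall>i\<in>- I\<^sub>0. (\<psi> (g i x) - \<psi> (g i y)) * (g i x - g i y) = 0"
    using pos by (subst (asm) sum_nonneg_eq_0_iff) (auto intro: psi_diff_mult_nonneg)
  then show "g i x = g i y" if "i \<notin> I\<^sub>0" for i
    using psi_diff_mult_eq_0[OF pos[of i]] that by simp
qed

text \<open>In the sum of the tangent inequalities the linear terms \<open>e i\<close> cancel by
  stationarity.\<close>

lemma bregman_stationary_less:
  assumes l: "bregman_stationary l" and y: "y \<in> S" "y \<noteq> l"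
  shows "(\<Sum>i\<in>- I\<^sub>0. bregman \<theta> (g i l) (g i x0)) < (\<Sum>i\<in>- I\<^sub>0. bregman \<theta> (g i y) (g i x0))"
proof -
  define D where "D i = finite_part \<theta> (g i l) - finite_part \<theta> (g i x0) - \<psi> (g i x0) * (g i l - g i x0)" for i
  define e where "e i = (\<psi> (g i l) - \<psi> (g i x0)) * (g i y - g i l)" for i
  define r where "r i = bregman \<theta> (g i y) (g i x0)" for i
  have D: "bregman \<theta> (g i l) (g i x0) = ereal (D i)" if "i \<in> - I\<^sub>0" for i
    using l that slack_pos[OF x0_open] by (simp add: D_def bregman_finite bregman_stationary_def)
  have less: "ereal (D i + e i) < r i" if "i \<in> - I\<^sub>0" "g i y \<noteq> g i l" for i
    using bregman_above_tangent[OF _ slack_pos[OF x0_open] slack_solution_nonneg[OF y(1)] that(2), of i] l that(1)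
    by (simp add: D e_def r_def bregman_stationary_def)
  have le: "ereal (D i + e i) \<le> r i" if "i \<in> - I\<^sub>0" for i
    using less[OF that] D[OF that] by (cases "g i y = g i l") (auto simp: e_def r_def)
  obtain j where j: "j \<notin> I\<^sub>0" "g j y \<noteq> g j l" using solution_eqI[of y l] y l by (auto simp: bregman_stationary_def)
  have "(\<Sum>i\<in>- I\<^sub>0. e i) = 0" using l y(1) by (simp add: bregman_stationary_def e_def)
  then have "(\<Sum>i\<in>- I\<^sub>0. ereal (D i)) = (\<Sum>i\<in>- I\<^sub>0. ereal (D i + e i))"
    by (simp add: sum.distrib)
  \<comment> \<open>Index \<open>j\<close> is split off because strictness survives addition in
    \<open>ereal\<close> only next to a finite summand: these real terms are finite, whereas
    \<open>r i\<close> may be infinite.\<close>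
  also have "\<dots> = (\<Sum>i\<in>- I\<^sub>0 - {j}. ereal (D i + e i)) + ereal (D j + e j)"
    using j(1) by (simp add: sum.remove add.commute)
  also have "\<dots> < (\<Sum>i\<in>- I\<^sub>0 - {j}. ereal (D i + e i)) + r j"
    using less[of j] j by (intro ereal_less_add) auto
  also have "\<dots> \<le> (\<Sum>i\<in>- I\<^sub>0 - {j}. r i) + r j"
    using le by (intro add_right_mono sum_mono) auto
  also have "\<dots> = (\<Sum>i\<in>- I\<^sub>0. r i)" using j(1) by (simp add: sum.remove add.commute)
  finally show ?thesis using D by (simp add: r_def)
qed

lemma cluster_point_bregman_stationary:
  assumes "\<And>k. 0 \<le> T k" "filterlim T at_top sequentially" "(\<lambda>k. central_path (T k)) \<longlonglongrightarrow> l"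
  shows "bregman_stationary l"
  using cluster_point_optimal[OF assms] cluster_point_slack_pos[OF assms]
    cluster_point_first_order[OF assms] by (simp add: bregman_stationary_def)

text \<open>The bound by \<open>k\<close> supplies nonnegative times and divergence to infinity at
  once.\<close>

lemma cluster_point_exists:
  assumes "\<And>k. real k \<le> T k"
  obtains r l where "strict_mono r" "(\<lambda>k. central_path (T (r k))) \<longlonglongrightarrow> l" "bregman_stationary l"
proof -
  have nonneg: "0 \<le> T k" for k using assms[of k] by (rule order_trans[OF of_nat_0_le_iff])
  then have "range (central_path \<circ> T) \<subseteq> central_path ` {0..}" by auto
  then have "bounded (range (central_path \<circ> T))" using bounded_central_path bounded_subset by blast
  then obtain l r where r: "strict_mono r" "((central_path \<circ> T) \<circ> r) \<longlonglongrightarrow> l"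
    using bounded_imp_convergent_subsequence by blast
  then have lim: "(\<lambda>k. central_path ((T \<circ> r) k)) \<longlonglongrightarrow> l" by (simp add: comp_def)
  have "filterlim T at_top sequentially"
    using filterlim_at_top_mono[OF filterlim_real_sequentially] assms by simp
  then have "filterlim (T \<circ> r) at_top sequentially"
    unfolding comp_def by (rule filterlim_compose[OF _ filterlim_subseq[OF r(1)]])
  then have "bregman_stationary l" using nonneg lim by (intro cluster_point_bregman_stationary[of "T \<circ> r"]) auto
  then show thesis using that r(1) lim by simp
qed

text \<open>The path is bounded and its cluster points at infinity are all stationary, hence equal.
  Times with distance at least \<open>e\<close> from \<open>l\<close> would produce another
  one.\<close>

lemma central_path_tendsto:
  obtains l where "bregman_stationary l" "(central_path \<longlongrightarrow> l) at_top"
proof -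
  obtain l where l: "bregman_stationary l" using cluster_point_exists[of real] by auto
  have "(central_path \<longlongrightarrow> l) at_top"
  proof (rule tendstoI, rule ccontr)
    fix e :: real assume e: "e > 0" "\<not> (\<forall>\<^sub>F t in at_top. dist (central_path t) l < e)"
    then have "\<forall>k. \<exists>t. real k \<le> t \<and> e \<le> dist (central_path t) l"
      by (auto simp: eventually_at_top_linorder not_less)
    then obtain T where T: "\<And>k. real k \<le> T k" "\<And>k. e \<le> dist (central_path (T k)) l" by metis
    obtain r l' where r: "(\<lambda>k. central_path (T (r k))) \<longlonglongrightarrow> l'" "bregman_stationary l'"
      using cluster_point_exists[of T] T(1) by metis
    then have "(\<lambda>k. central_path (T (r k))) \<longlonglongrightarrow> l" using bregman_stationary_unique l by metis
    then have "\<forall>\<^sub>F k in sequentially. dist (central_path (T (r k))) l < e" using e(1) by (rule tendstoD)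
    then show False using T(2) by (auto simp: eventually_sequentially not_le[symmetric])
  qed
  with l show thesis by (rule that)
qed

end

theorem proposition4p4:
  fixes c x0 :: "real^'n"
    and A :: "real^'n^'m" and b :: "real^'m"
    and B :: "real^'n^'p" and d :: "real^'p"
    and \<theta> :: "real \<Rightarrow> ereal"
  assumes dim_A: "CARD('m) < CARD('n)" and rank_A: "full_rank A" and b_in: "b \<in> range ((*v) A)"
    and dim_B: "CARD('n) \<le> CARD('p)" and rank_B: "full_rank B"
    and S_nonempty: "LP_solutions c A b B d \<noteq> {}"
    and S_bounded: "bounded (LP_solutions c A b B d)"
    and x0_interior: "\<forall>i. d $ i < (B *v x0) $ i" and x0_affine: "A *v x0 = b"
    and theta_legendre: "legendre_type \<theta>"
    and theta_dom: "{0<..} \<subseteq> effective_domain \<theta>" "effective_domain \<theta> \<subseteq> {0..}"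
    and theta_C3: "Ck_on 3 {0<..} (finite_part \<theta>)"
    and theta_deriv: "filterlim (deriv (finite_part \<theta>)) at_bot (at_right 0)"
    and theta_deriv2: "\<forall>s>0. deriv (deriv (finite_part \<theta>)) s > 0"
  shows "HSD_well_posed (LP_open_set B d) A b (LP_barrier \<theta> B d) (\<lambda>x. c \<bullet> x) x0 \<and>
    (\<exists>xs.
       (\<forall>y. is_arg_min
              (\<lambda>x. \<Sum>i\<in>- LP_always_active c A b B d.
                     bregman \<theta> (slack B d i x) (slack B d i x0))
              (\<lambda>x. x \<in> LP_solutions c A b B d) y \<longleftrightarrow> y = xs) \<and>
       (\<forall>Tm TM x. HSD_maximal_solution (LP_open_set B d) A b (LP_barrier \<theta> B d)
                     (\<lambda>x. c \<bullet> x) x0 Tm TM x \<longrightarrow>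
          (x \<longlongrightarrow> xs) at_top))"
proof -
  interpret linear_program_barrier c x0 A b B d \<theta>
  proof
    show "surj ((*v) A)"
      using dim_A rank_A by (simp add: full_rank_def full_rank_surjective[symmetric])
    show "inj ((*v) B)"
      using dim_B rank_B by (simp add: full_rank_def full_rank_injective[symmetric])
    show "x0 \<in> LP_open_set B d" using x0_interior by (simp add: LP_open_set_def)
    show "\<theta> \<in> Gamma0" using theta_legendre by (simp add: legendre_type_def)
  qed (use assms in auto)
  obtain l where l: "bregman_stationary l" and lim: "(central_path \<longlongrightarrow> l) at_top"
    by (rule central_path_tendsto)
  \<comment> \<open>For \<open>t \<ge> 0\<close> every maximal solution agrees with
    \<open>central_path\<close> and inherits its limit.\<close>
  have "(y \<longlongrightarrow> l) at_top" if "maximal_solution Tm TM y" for Tm TM y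
  proof (rule Lim_transform_eventually[OF lim])
    show "\<forall>\<^sub>F t in at_top. central_path t = y t"
      using well_posedI(2)[OF nonneg_subset_times that] by (intro eventually_at_top_linorderI[of 0]) simp
  qed
  moreover have "is_arg_min (\<lambda>x. \<Sum>i\<in>- I\<^sub>0. bregman \<theta> (g i x) (g i x0)) (\<lambda>x. x \<in> S) y \<longleftrightarrow> y = l" for y
  proof -
    have "l \<in> S" using l by (simp add: bregman_stationary_def)
    then show ?thesis
      using bregman_stationary_less[OF l] unfolding is_arg_min_def by (blast dest: less_asym)
  qed
  ultimately show ?thesis using well_posedI(1)[OF nonneg_subset_times] by blast
qed

end
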